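(* Let $n\ge 2$ and let $S_n$ be the star tree on the $n+1$ leaves $0,1,\dots,n$, rooted at the leaf $0$. The reciprocal maximum likelihood degree of the Brownian motion tree model $\mathcal{M}_{S_n}$ is equal to $2^n-n-1$.
   Context: The star tree $S_n$ is the tree on leaves $0,\dots,n$ with a unique internal vertex; it is rooted at the leaf $0$ with edges directed away from the root. For non-root leaves $i,j$, $\mathrm{lca}(i,j)$ is their most recent common ancestor, with $\mathrm{lca}(i,i)=i$; for $i\neq j$ it is the unique internal vertex. Let $\mathbb{S}^n$ be the space of symmetric $n\times n$ matrices, and let $$\mathcal{L}_{S_n}=\{\Sigma\in\mathbb{S}^n\mid\sigma_{ij}=\sigma_{kl}\text{ whenever }\mathrm{lca}(i,j)=\mathrm{lca}(k,l)\}.$$ Thus $\mathcal{L}_{S_n}$ consists of the symmetric matrices with arbitrary diagonal entries and all off-diagonal entries equal to each other. The Brownian motion tree model is $\mathcal{M}_{S_n}=\mathcal{L}_{S_n}\cap\mathbb{S}^n_{>0}$, where $\mathbb{S}^n_{>0}$ is the set of positive-definite matrices. The reciprocal log-likelihood function is $\ell_S^\vee(\Sigma)=\log\det(\Sigma)-\mathrm{trace}(S^{-1}\Sigma)$. The reciprocal maximum likelihood degree is the number, counted with multiplicity, of non-singular complex critical points of $\ell_S^\vee$ in parameters from the model, for generic symmetric $S$. That is, it is the number of invertible complex $\Sigma$ in the complexification of $\mathcal{L}_{S_n}$ with $\mathrm{trace}(\Sigma^{-1}E)=\mathrm{trace}(S^{-1}E)$ for all $E\in\mathcal{L}_{S_n}$,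 counted with multiplicity. *)

theory Defs
  imports "HOL-Analysis.Analysis" "HOL-Library.Extended_Nat"
begin

section \<open>The star tree\<close>

text \<open>The leaf \<open>0\<close> is \<open>Root\<close>; the leaves \<open>1, \<dots>, n\<close> are \<open>Leaf i\<close> for \<open>i\<close> in an arbitrary finite
  type \<open>'n\<close> with \<open>CARD('n) = n\<close>, so that they also index the rows and columns of the matrices.\<close>

datatype 'n star_vertex = Root | Inner | Leaf 'n

definition star_edges :: "('n star_vertex \<times> 'n star_vertex) set" where
  "star_edges = insert (Root, Inner) {(Inner, Leaf i) |i. True}"

text \<open>Ancestry is reflexive: a vertex is an ancestor of itself.\<close>

definition ancestor :: "'n star_vertex \<Rightarrow> 'n star_vertex \<Rightarrow> bool" where
  "ancestor u v \<longleftrightarrow> (u, v) \<in> star_edges\<^sup>*"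

definition lca :: "'n \<Rightarrow> 'n \<Rightarrow> 'n star_vertex" where
  "lca i j = (THE v. ancestor v (Leaf i) \<and> ancestor v (Leaf j) \<and>
     (\<forall>u. ancestor u (Leaf i) \<and> ancestor u (Leaf j) \<longrightarrow> ancestor u v))"

section \<open>The Brownian motion tree model\<close>

definition star_space :: "(real^'n^'n) set" where
  "star_space = {\<Sigma>. transpose \<Sigma> = \<Sigma> \<and>
     (\<forall>i j k l. lca i j = lca k l \<longrightarrow> \<Sigma> $ i $ j = \<Sigma> $ k $ l)}"

definition pos_def :: "real^'n^'n \<Rightarrow> bool" where
  "pos_def A \<longleftrightarrow> transpose A = A \<and> (\<forall>x. x \<noteq> 0 \<longrightarrow> 0 < x \<bullet> (A *v x))"

definition star_BM_model :: "(real^'n^'n) set" where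
  "star_BM_model = star_space \<inter> {\<Sigma>. pos_def \<Sigma>}"

section \<open>Polynomial functions and genericity\<close>

inductive_set poly_fun :: "(complex^'n^'n \<Rightarrow> complex) set" where
  const: "(\<lambda>X. c) \<in> poly_fun"
| entry: "(\<lambda>X. X $ i $ j) \<in> poly_fun"
| add: "f \<in> poly_fun \<Longrightarrow> g \<in> poly_fun \<Longrightarrow> (\<lambda>X. f X + g X) \<in> poly_fun"
| mult: "f \<in> poly_fun \<Longrightarrow> g \<in> poly_fun \<Longrightarrow> (\<lambda>X. f X * g X) \<in> poly_fun"

text \<open>A property holds for generic symmetric matrices if it holds on a nonempty Zariski-open
  subset of the space of complex symmetric matrices. As real matrices are Zariski dense there,
  it then also holds for generic real symmetric matrices.\<close>

definition generic_symmetric :: "(complex^'n^'n \<Rightarrow> bool) \<Rightarrow> bool" where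
  "generic_symmetric P \<longleftrightarrow> (\<exists>F\<in>poly_fun.
     (\<exists>S. transpose S = S \<and> F S \<noteq> 0) \<and>
     (\<forall>S. transpose S = S \<and> F S \<noteq> 0 \<longrightarrow> P S))"

section \<open>Critical points and their multiplicities\<close>

definition complexification :: "(real^'n^'n) set \<Rightarrow> (complex^'n^'n) set" where
  "complexification L = {X. (\<chi> i j. Re (X $ i $ j)) \<in> L \<and> (\<chi> i j. Im (X $ i $ j)) \<in> L}"

text \<open>The derivative at \<open>X\<close>, in direction \<open>E\<close>, of \<open>log det X - trace (S\<inverse> X)\<close>.\<close>

definition score ::
  "complex^'n^'n \<Rightarrow> complex^'n^'n \<Rightarrow> complex^'n^'n \<Rightarrow> complex" where
  "score S E X = trace (matrix_inv X ** E) - trace (matrix_inv S ** E)"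

definition critical_points ::
  "(complex^'n^'n) set \<Rightarrow> complex^'n^'n \<Rightarrow> (complex^'n^'n) set" where
  "critical_points L S = {X \<in> L. invertible X \<and> (\<forall>E\<in>L. score S E X = 0)}"

text \<open>The local ring of the affine space \<open>L\<close> at \<open>P \<in> L\<close>, that is, the rational functions on \<open>L\<close>
  whose denominator does not vanish at \<open>P\<close>. They are represented by functions on all matrices of
  which only the germ at \<open>P\<close> along \<open>L\<close> matters; two rational functions on \<open>L\<close> regular at \<open>P\<close> are
  equal if and only if these germs are.\<close>

definition local_ring ::
  "(complex^'n^'n) set \<Rightarrow> complex^'n^'n \<Rightarrow> (complex^'n^'n \<Rightarrow> complex) set" where
  "local_ring L P = {f. \<exists>a\<in>poly_fun. \<exists>b\<in>poly_fun. b P \<noteq> 0 \<and>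
     (\<forall>\<^sub>F X in inf (nhds P) (principal L). f X = a X / b X)}"

text \<open>The ideal of \<open>local_ring L P\<close> generated by the functions \<open>score S E\<close> with \<open>E \<in> L\<close>; near an
  invertible \<open>P\<close> these are indeed rational functions.\<close>

definition score_ideal ::
  "(complex^'n^'n) set \<Rightarrow> complex^'n^'n \<Rightarrow> complex^'n^'n \<Rightarrow> (complex^'n^'n \<Rightarrow> complex) set" where
  "score_ideal L S P = {f. \<exists>B h. finite B \<and> B \<subseteq> L \<and> (\<forall>E\<in>B. h E \<in> local_ring L P) \<and>
     (\<forall>\<^sub>F X in inf (nhds P) (principal L). f X = (\<Sum>E\<in>B. h E X * score S E X))}"

text \<open>The dimension of the quotient \<open>V / W\<close> of two complex vector spaces of functions.\<close>

definition quotient_dim :: "('a \<Rightarrow> complex) set \<Rightarrow> ('a \<Rightarrow> complex) set \<Rightarrow> enat" where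
  "quotient_dim V W = (SUP B \<in> {B. finite B \<and> B \<subseteq> V \<and>
     (\<forall>c. (\<lambda>x. \<Sum>b\<in>B. c b * b x) \<in> W \<longrightarrow> (\<forall>b\<in>B. c b = 0))}. enat (card B))"

definition multiplicity_at ::
  "(complex^'n^'n) set \<Rightarrow> complex^'n^'n \<Rightarrow> complex^'n^'n \<Rightarrow> enat" where
  "multiplicity_at L S P = quotient_dim (local_ring L P) (score_ideal L S P)"

definition critical_count :: "(complex^'n^'n) set \<Rightarrow> complex^'n^'n \<Rightarrow> enat" where
  "critical_count L S = (if finite (critical_points L S)
     then (\<Sum>P\<in>critical_points L S. multiplicity_at L S P) else \<infinity>)"

text \<open>For a model \<open>M\<close> that is the set of positive definite matrices in a linear space, the number of
  critical points is taken over the complexification of that space, which is recovered as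
  \<open>span M\<close> (see \<open>span_star_BM_model\<close> below). There is at most one such \<open>d\<close>, since any two nonempty
  Zariski-open sets of symmetric matrices intersect.\<close>

definition has_reciprocal_ml_degree :: "(real^'n^'n) set \<Rightarrow> nat \<Rightarrow> bool" where
  "has_reciprocal_ml_degree M d \<longleftrightarrow> generic_symmetric
     (\<lambda>S. invertible S \<and> critical_count (complexification (span M)) S = enat d)"

section \<open>Basic facts\<close>

lemma ancestor_Leaf_iff: "ancestor u (Leaf i) \<longleftrightarrow> u \<in> {Root, Inner, Leaf i}"
proof
  assume "ancestor u (Leaf i)"
  then have "(u, Leaf i) \<in> star_edges\<^sup>*" by (simp add: ancestor_def)
  then show "u \<in> {Root, Inner, Leaf i}"
    by (induction rule: converse_rtrancl_induct) (auto simp: star_edges_def)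
next
  have *: "(Root, Inner) \<in> star_edges" "(Inner, Leaf i) \<in> star_edges"
    by (auto simp: star_edges_def)
  assume "u \<in> {Root, Inner, Leaf i}"
  with * show "ancestor u (Leaf i)"
    unfolding ancestor_def by (auto intro: r_into_rtrancl rtrancl_trans)
qed

lemma ancestor_Inner_iff: "ancestor u Inner \<longleftrightarrow> u \<in> {Root, Inner}"
proof
  assume "ancestor u Inner"
  then have "(u, Inner) \<in> star_edges\<^sup>*" by (simp add: ancestor_def)
  then show "u \<in> {Root, Inner}"
    by (induction rule: converse_rtrancl_induct) (auto simp: star_edges_def)
qed (auto simp: ancestor_def star_edges_def)

lemma ancestor_Root_iff: "ancestor u Root \<longleftrightarrow> u = Root"
proof
  assume "ancestor u Root"
  then have "(u, Root) \<in> star_edges\<^sup>*" by (simp add: ancestor_def)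
  then show "u = Root"
    by (induction rule: converse_rtrancl_induct) (auto simp: star_edges_def)
qed (auto simp: ancestor_def)

lemma lca_eq: "lca i j = (if i = j then Leaf i else Inner)"
  unfolding lca_def
  by (rule the_equality)
     (auto simp: ancestor_Leaf_iff ancestor_Inner_iff ancestor_Root_iff split: if_splits)

lemma star_space_altdef:
  "star_space = {\<Sigma>::real^'n^'n. \<forall>i j k l. i \<noteq> j \<and> k \<noteq> l \<longrightarrow> \<Sigma> $ i $ j = \<Sigma> $ k $ l}"
proof (rule set_eqI, unfold mem_Collect_eq, rule iffI)
  fix \<Sigma> :: "real^'n^'n"
  assume "\<Sigma> \<in> star_space"
  then show "\<forall>i j k l. i \<noteq> j \<and> k \<noteq> l \<longrightarrow> \<Sigma> $ i $ j = \<Sigma> $ k $ l"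
    by (simp add: star_space_def lca_eq)
next
  fix \<Sigma> :: "real^'n^'n"
  assume *: "\<forall>i j k l. i \<noteq> j \<and> k \<noteq> l \<longrightarrow> \<Sigma> $ i $ j = \<Sigma> $ k $ l"
  have "\<Sigma> $ j $ i = \<Sigma> $ i $ j" for i j
  proof (cases "i = j")
    case False
    then show ?thesis using *[rule_format, of j i i j] by blast
  qed simp
  then have "transpose \<Sigma> = \<Sigma>"
    by (simp add: transpose_def vec_eq_iff)
  moreover have "\<Sigma> $ i $ j = \<Sigma> $ k $ l" if "lca i j = lca k l" for i j k l
  proof (cases "i = j")
    case True
    then show ?thesis using that by (simp add: lca_eq split: if_splits)
  next
    case False
    then have "k \<noteq> l" using that by (auto simp: lca_eq)
    with False show ?thesis using *[rule_format, of i j k l] by blast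
  qed
  ultimately show "\<Sigma> \<in> star_space"
    unfolding star_space_def by blast
qed

lemma subspace_star_space: "subspace (star_space :: (real^'n^'n) set)"
proof (rule subspaceI)
  fix x y :: "real^'n^'n" and c :: real
  show "0 \<in> (star_space :: (real^'n^'n) set)"
    unfolding star_space_altdef mem_Collect_eq by (intro allI impI) simp
  assume x: "x \<in> star_space"
  show "c *\<^sub>R x \<in> star_space"
    unfolding star_space_altdef mem_Collect_eq
  proof (intro allI impI)
    fix i j k l :: 'n assume "i \<noteq> j \<and> k \<noteq> l"
    then have "x $ i $ j = x $ k $ l" using x unfolding star_space_altdef by blast
    then show "(c *\<^sub>R x) $ i $ j = (c *\<^sub>R x) $ k $ l" by simp
  qed
  assume y: "y \<in> star_space"
  show "x + y \<in> star_space"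
    unfolding star_space_altdef mem_Collect_eq
  proof (intro allI impI)
    fix i j k l :: 'n assume "i \<noteq> j \<and> k \<noteq> l"
    then have "x $ i $ j = x $ k $ l" "y $ i $ j = y $ k $ l"
      using x y unfolding star_space_altdef by blast+
    then show "(x + y) $ i $ j = (x + y) $ k $ l" by simp
  qed
qed

lemma span_star_BM_model: "span star_BM_model = (star_space :: (real^'n^'n) set)"
proof
  show "span star_BM_model \<subseteq> (star_space :: (real^'n^'n) set)"
    by (rule span_minimal) (auto simp: star_BM_model_def subspace_star_space)
next
  show "(star_space :: (real^'n^'n) set) \<subseteq> span star_BM_model"
  proof
    fix A :: "real^'n^'n"
    assume A: "A \<in> star_space"
    obtain K where K: "K > 0" "\<And>x. norm (A *v x) \<le> norm x * K"
      using bounded_linear.pos_bounded[OF matrix_vector_mul_bounded_linear[of A]] by auto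
    have id: "mat c \<in> (star_space :: (real^'n^'n) set)" for c
      by (auto simp: star_space_altdef mat_def)
    have mat_vec: "mat c *v x = c *\<^sub>R x" for c :: real and x :: "real^'n"
      by (simp add: vec_eq_iff matrix_vector_mult_def mat_def if_distribR[of _ "(*) _"]
          if_distrib[of "\<lambda>a. a * _"] cong: if_cong)
    have id_pd: "mat (K + 1) \<in> (star_BM_model :: (real^'n^'n) set)"
      using id K(1) by (auto simp: star_BM_model_def pos_def_def mat_vec)
    have "0 < x \<bullet> ((A + mat (K + 1)) *v x)" if "x \<noteq> 0" for x
    proof -
      have "\<bar>x \<bullet> (A *v x)\<bar> \<le> norm x * norm (A *v x)"
        by (rule Cauchy_Schwarz_ineq2)
      also have "\<dots> \<le> norm x * (norm x * K)"
        using K(2) by (intro mult_left_mono) auto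
      finally have 1: "- (K * (x \<bullet> x)) \<le> x \<bullet> (A *v x)"
        by (simp add: norm_eq_sqrt_inner algebra_simps)
      have "x \<bullet> ((A + mat (K + 1)) *v x) = x \<bullet> (A *v x) + K * (x \<bullet> x) + x \<bullet> x"
        by (simp add: matrix_vector_mult_add_rdistrib mat_vec inner_add_right algebra_simps)
      moreover have "0 < x \<bullet> x" using that by simp
      ultimately show ?thesis using 1 by linarith
    qed
    moreover have mem: "A + mat (K + 1) \<in> star_space"
      by (rule subspace_add[OF subspace_star_space A id])
    moreover have "transpose (A + mat (K + 1)) = A + mat (K + 1)"
      using mem unfolding star_space_def by blast
    ultimately have sum_pd: "A + mat (K + 1) \<in> star_BM_model"
      unfolding star_BM_model_def pos_def_def by blast
    have "A + mat (K + 1) - mat (K + 1) \<in> span star_BM_model"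
      by (intro span_diff span_base sum_pd id_pd)
    then show "A \<in> span star_BM_model" by simp
  qed
qed

end

theory Submission
  imports Defs "Subresultants.Subresultant_Gcd" "HOL-Computational_Algebra.Field_as_Ring"
    "HOL-Computational_Algebra.Fundamental_Theorem_Algebra"
begin

text \<open>Write a matrix of the complexified model as \<open>X = diag d + t J\<close>, where \<open>J\<close> is the all-ones matrix,
and let \<open>k\<^sub>i\<close> be the diagonal entries of \<open>S\<inverse>\<close> and \<open>s\<close> the sum of all its entries.  Then \<open>X\<close> is critical
if and only if \<open>X\<inverse>\<close> has the same diagonal and the same entry sum (\<open>critical_points_star_iff\<close>).  If no \<open>d\<^sub>i\<close>
vanishes, then \<open>X\<inverse> = diag u - \<tau> u u\<^sup>T\<close> with \<open>u\<^sub>i = 1 / d\<^sub>i\<close>, so that the critical points are the solutions of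
\<open>u\<^sub>i - \<tau> u\<^sub>i\<^sup>2 = k\<^sub>i\<close> and \<open>p - \<tau> p\<^sup>2 = s\<close>, where \<open>p = \<Sum> u\<^sub>i\<close>.  A critical point with \<open>d\<^sub>a = 0\<close> forces
\<open>s = 2 k\<^sub>a - \<Sum> k\<^sub>i\<close>, and one with \<open>\<tau> = 0\<close> forces \<open>s = \<Sum> k\<^sub>i\<close>; generic \<open>S\<close> satisfy neither equation
(\<open>critical_points_eq_solutions\<close>).  Completing squares by \<open>v\<^sub>i = 1 - 2 \<tau> u\<^sub>i\<close> and \<open>y = 4 \<tau>\<close> turns the system into
\<open>v\<^sub>i\<^sup>2 = 1 - y k\<^sub>i\<close> and \<open>(1 - n + \<Sum> v\<^sub>i)\<^sup>2 = 1 - s y\<close>: a critical point is a number \<open>y \<noteq> 0\<close> together with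
a choice of square roots \<open>v\<^sub>i\<close> of \<open>1 - y k\<^sub>i\<close> that satisfies one more equation.

The product of \<open>(1 - n + \<Sum> \<plusminus>v\<^sub>i)\<^sup>2 - 1 + s y\<close> over all \<open>2\<^sup>n\<close> sign choices is a polynomial \<open>N\<close> in \<open>y\<close>
whose coefficients are polynomials in \<open>k\<close> and \<open>s\<close> (\<open>branch_poly_exists\<close>).  Every factor grows at most
linearly, so \<open>N\<close> has degree at most \<open>2\<^sup>n\<close> (\<open>branch_poly_degree_le\<close>).  At \<open>y = 0\<close> the square roots are \<open>\<plusminus>1\<close>, and
the factor with \<open>b\<close> minus signs takes the value \<open>4 b (b - 1)\<close> there; the \<open>n + 1\<close> factors with \<open>b \<le> 1\<close> vanish,
so \<open>y\<^bsup>n+1\<^esup>\<close> divides \<open>N\<close> (\<open>branch_poly_order_ge\<close>).  The cofactor \<open>M\<close> has degree at most \<open>2\<^sup>n - n - 1\<close>.  For suitable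
real \<open>k\<close> and all large real \<open>s\<close> it has that many distinct nonzero roots, because the factor with \<open>b \<ge> 2\<close> minus signs
changes its sign near \<open>-4 b (b - 1) / s\<close> (\<open>branch_poly_many_roots\<close>).  That \<open>M\<close> has full degree and only
simple nonzero roots is the nonvanishing of two coefficients and of the resultant of \<open>M\<close> and its
derivative, hence generic.

Finally, a simple root \<open>y\<close> of \<open>N\<close> at which no \<open>v\<^sub>i\<close> vanishes is a root of exactly one factor, and a simple root
of that factor (\<open>branch_poly_simple_root\<close>).  The first property makes critical points and nonzero roots
correspond bijectively, and the second one says that the Hessian of the likelihood on the model is
nondegenerate (\<open>solution_nondegenerate\<close>).  At such a point the scores generate the maximal ideal of the local
ring, and the multiplicity is one (\<open>nondegenerate_multiplicity_1\<close>).  So the count, with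
multiplicities, is \<open>2\<^sup>n - n - 1\<close>.\<close>

hide_const (open) Matrix.mat Matrix.row Matrix.vec Determinant.det
  Module.smult
hide_fact (open) Matrix.vec_eq_iff Matrix.mat_def Determinant.det_def
no_notation vec_index (infixl "$" 100)

section \<open>Algebras of functions\<close>

text \<open>The instances below are the polynomials in arbitrary variables, the polynomials in the entries of
a matrix, the local ring at a point, and the rational functions of a matrix whose denominator is a power of the determinant.\<close>

locale function_algebra =
  fixes C :: "('a \<Rightarrow> complex) set"
  assumes const: "(\<lambda>x. c) \<in> C"
    and add: "f \<in> C \<Longrightarrow> g \<in> C \<Longrightarrow> (\<lambda>x. f x + g x) \<in> C"
    and mult: "f \<in> C \<Longrightarrow> g \<in> C \<Longrightarrow> (\<lambda>x. f x * g x) \<in> C"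
begin

lemma uminus: "f \<in> C \<Longrightarrow> (\<lambda>x. - f x) \<in> C"
  using mult[OF const[of "-1"]] by simp

lemma diff: "f \<in> C \<Longrightarrow> g \<in> C \<Longrightarrow> (\<lambda>x. f x - g x) \<in> C"
  using add[OF _ uminus, of f g] by simp

lemma power: "f \<in> C \<Longrightarrow> (\<lambda>x. f x ^ n) \<in> C"
  by (induction n) (auto intro: const mult)

lemma sum: "(\<And>i. i \<in> I \<Longrightarrow> f i \<in> C) \<Longrightarrow> (\<lambda>x. \<Sum>i\<in>I. f i x) \<in> C"
  by (induction I rule: infinite_finite_induct) (auto intro: const add)

lemma prod: "(\<And>i. i \<in> I \<Longrightarrow> f i \<in> C) \<Longrightarrow> (\<lambda>x. \<Prod>i\<in>I. f i x) \<in> C"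
  by (induction I rule: infinite_finite_induct) (auto intro: const mult)

lemma if_const_cond: "f \<in> C \<Longrightarrow> g \<in> C \<Longrightarrow> (\<lambda>x. if Q then f x else g x) \<in> C"
  by (cases Q) simp_all

lemma det:
  fixes M :: "'a \<Rightarrow> complex^'m^'m"
  assumes "\<And>i j. (\<lambda>x. M x $ i $ j) \<in> C"
  shows "(\<lambda>x. det (M x)) \<in> C"
  unfolding Determinants.det_def by (intro sum mult const prod assms)

lemma resultant_sub:
  assumes "\<And>j. (\<lambda>x. coeff (p x) j) \<in> C" and "\<And>j. (\<lambda>x. coeff (q x) j) \<in> C"
  shows "(\<lambda>x. resultant_sub m n (p x) (q x)) \<in> C"
proof -
  let ?S = "\<lambda>x. sylvester_mat_sub m n (p x) (q x)"
  have entry: "(\<lambda>x. ?S x $$ (i, j)) \<in> C" if "i < m + n" "j < m + n" for i j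
    unfolding sylvester_mat_sub_index[OF that] by (intro if_const_cond assms const)
  have "(\<lambda>x. \<Sum>\<pi>\<in>{\<pi>. \<pi> permutes {0..<m+n}}. signof \<pi> * (\<Prod>i=0..<m+n. ?S x $$ (i, \<pi> i))) \<in> C"
    by (intro sum mult const prod entry) (auto simp: permutes_in_image)
  also have "(\<lambda>x. \<Sum>\<pi>\<in>{\<pi>. \<pi> permutes {0..<m+n}}. signof \<pi> * (\<Prod>i=0..<m+n. ?S x $$ (i, \<pi> i))) =
      (\<lambda>x. resultant_sub m n (p x) (q x))"
    by (simp add: resultant_sub_def Determinant.det_def)
  finally show ?thesis .
qed

end

lemma resultant_zero_iff_common_root:
  fixes p q :: "complex poly"
  assumes "p \<noteq> 0"
  shows "resultant p q = 0 \<longleftrightarrow> (\<exists>z. poly p z = 0 \<and> poly q z = 0)"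
proof -
  have "resultant p q = 0 \<longleftrightarrow> degree (gcd p q) \<noteq> 0"
    by (rule resultant_0_gcd)
  also have "\<dots> \<longleftrightarrow> (\<exists>z. poly (gcd p q) z = 0)"
    using fundamental_theorem_of_algebra[of "gcd p q"] assms
    by (metis constant_degree degree_0_id gcd_eq_0_iff poly_const_conv pCons_0_0)
  also have "\<dots> \<longleftrightarrow> (\<exists>z. poly p z = 0 \<and> poly q z = 0)"
    unfolding poly_eq_0_iff_dvd by simp
  finally show ?thesis .
qed

section \<open>Norms over sign changes\<close>

inductive_set poly_in :: "(('v \<Rightarrow> complex) \<Rightarrow> complex) set" where
  const_in: "(\<lambda>e. c) \<in> poly_in"
| var_in: "(\<lambda>e. e v) \<in> poly_in"
| add_in: "f \<in> poly_in \<Longrightarrow> g \<in> poly_in \<Longrightarrow> (\<lambda>e. f e + g e) \<in> poly_in"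
| mult_in: "f \<in> poly_in \<Longrightarrow> g \<in> poly_in \<Longrightarrow> (\<lambda>e. f e * g e) \<in> poly_in"

interpretation poly_in: function_algebra poly_in
  by unfold_locales (auto intro: poly_in.intros)

text \<open>The decomposition of a polynomial into its even and its odd part in the variable \<open>v\<close>, both
expressed through the square of \<open>v\<close>.\<close>

lemma even_odd_split:
  assumes "f \<in> poly_in"
  shows "\<exists>a\<in>poly_in. \<exists>b\<in>poly_in. \<forall>e. f e = a (e(v := (e v)\<^sup>2)) + e v * b (e(v := (e v)\<^sup>2))"
  using assms
proof induction
  case (const_in c)
  show ?case
    by (rule bexI[OF _ poly_in.const[of c]], rule bexI[OF _ poly_in.const[of 0]]) simp
next
  case (var_in w)
  show ?case
  proof (cases "w = v")
    case True
    show ?thesis unfolding True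
      by (rule bexI[OF _ poly_in.const[of 0]], rule bexI[OF _ poly_in.const[of 1]]) simp
  next
    case False
    then show ?thesis
      by (intro bexI[OF _ poly_in.var_in[of w]] bexI[OF _ poly_in.const[of 0]]) simp
  qed
next
  case (add_in f g)
  then obtain a b a' b' where *:
    "a \<in> poly_in" "b \<in> poly_in" "a' \<in> poly_in" "b' \<in> poly_in"
    "\<forall>e. f e = a (e(v := (e v)\<^sup>2)) + e v * b (e(v := (e v)\<^sup>2))"
    "\<forall>e. g e = a' (e(v := (e v)\<^sup>2)) + e v * b' (e(v := (e v)\<^sup>2))" by blast
  have "(\<lambda>e. a e + a' e) \<in> poly_in" "(\<lambda>e. b e + b' e) \<in> poly_in"
    by (intro poly_in.intros *)+
  note mem = this
  show ?case
    by (rule rev_bexI[OF mem(1)], rule rev_bexI[OF mem(2)]) (use * in \<open>simp add: algebra_simps del: fun_upd_apply\<close>)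
next
  case (mult_in f g)
  then obtain a b a' b' where *:
    "a \<in> poly_in" "b \<in> poly_in" "a' \<in> poly_in" "b' \<in> poly_in"
    "\<forall>e. f e = a (e(v := (e v)\<^sup>2)) + e v * b (e(v := (e v)\<^sup>2))"
    "\<forall>e. g e = a' (e(v := (e v)\<^sup>2)) + e v * b' (e(v := (e v)\<^sup>2))" by blast
  have "(\<lambda>e. a e * a' e + e v * (b e * b' e)) \<in> poly_in"
       "(\<lambda>e. a e * b' e + b e * a' e) \<in> poly_in"
    by (intro poly_in.intros *)+
  note mem = this
  show ?case
    by (rule rev_bexI[OF mem(1)], rule rev_bexI[OF mem(2)]) (use * in \<open>simp add: algebra_simps power2_eq_square fun_upd_same del: fun_upd_apply\<close>)
qed

lemma even_product:
  assumes "f \<in> poly_in"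
  shows "\<exists>g\<in>poly_in. \<forall>e. f e * f (e(v := - e v)) = g (e(v := (e v)\<^sup>2))"
proof -
  obtain a b where *: "a \<in> poly_in" "b \<in> poly_in"
    "\<And>e. f e = a (e(v := (e v)\<^sup>2)) + e v * b (e(v := (e v)\<^sup>2))"
    using even_odd_split[OF assms] by blast
  have "(\<lambda>e. (a e)\<^sup>2 - e v * (b e)\<^sup>2) \<in> poly_in"
    by (intro poly_in.diff poly_in.power poly_in.mult poly_in.var_in *)
  then show ?thesis
    by (rule rev_bexI) (simp add: *(3) algebra_simps power2_eq_square)
qed

definition flip :: "'v set \<Rightarrow> ('v \<Rightarrow> 'a::uminus) \<Rightarrow> 'v \<Rightarrow> 'a" where
  "flip B r = (\<lambda>v. if v \<in> B then - r v else r v)"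

text \<open>The product over all sign changes is invariant under each of them, hence depends on the squares of the
variables only.  Variables are treated one at a time: \<open>(a + v b) (a - v b) = a\<^sup>2 - v\<^sup>2 b\<^sup>2\<close>.\<close>

lemma sign_norm_exists:
  assumes "finite A" "f \<in> poly_in"
  shows "\<exists>g\<in>poly_in. \<forall>e. (\<Prod>B\<in>Pow A. f (flip B e)) = g (\<lambda>v. if v \<in> A then (e v)\<^sup>2 else e v)"
  using assms(1)
proof induction
  case empty
  show ?case by (rule bexI[OF _ assms(2)]) (simp add: flip_def)
next
  case (insert v A)
  then obtain g where g: "g \<in> poly_in"
    "\<And>e. (\<Prod>B\<in>Pow A. f (flip B e)) = g (\<lambda>v. if v \<in> A then (e v)\<^sup>2 else e v)" by blast
  obtain h where h: "h \<in> poly_in" "\<And>e. g e * g (e(v := - e v)) = h (e(v := (e v)\<^sup>2))"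
    using even_product[OF g(1)] by blast
  have "(\<Prod>B\<in>Pow (insert v A). f (flip B e)) = h (\<lambda>w. if w \<in> insert v A then (e w)\<^sup>2 else e w)" for e
  proof -
    define E where "E = (\<lambda>w. if w \<in> A then (e w)\<^sup>2 else e w)"
    have disj: "Pow A \<inter> Set.insert v ` Pow A = {}"
      and inj: "inj_on (Set.insert v) (Pow A)"
      using insert.hyps(2) by (auto simp: inj_on_def)
    have "flip (Set.insert v B) e = flip B (e(v := - e v))" if "B \<subseteq> A" for B
      using that insert.hyps(2) by (auto simp: flip_def fun_eq_iff)
    then have "(\<Prod>B\<in>Set.insert v ` Pow A. f (flip B e)) = (\<Prod>B\<in>Pow A. f (flip B (e(v := - e v))))"
      by (simp add: prod.reindex[OF inj])
    then have "(\<Prod>B\<in>Pow (insert v A). f (flip B e)) =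
        (\<Prod>B\<in>Pow A. f (flip B e)) * (\<Prod>B\<in>Pow A. f (flip B (e(v := - e v))))"
      unfolding Pow_insert using insert.hyps(1) disj by (subst prod.union_disjoint) auto
    also have "(\<lambda>w. if w \<in> A then ((e(v := - e v)) w)\<^sup>2 else (e(v := - e v)) w) = E(v := - E v)"
      using insert.hyps(2) by (auto simp: E_def fun_eq_iff)
    then have "(\<Prod>B\<in>Pow A. f (flip B (e(v := - e v)))) = g (E(v := - E v))"
      by (simp only: g(2))
    also have "(\<Prod>B\<in>Pow A. f (flip B e)) = g E" by (simp add: g(2) E_def)
    also have "g E * g (E(v := - E v)) = h (E(v := (E v)\<^sup>2))" by (rule h(2))
    also have "E(v := (E v)\<^sup>2) = (\<lambda>w. if w \<in> insert v A then (e w)\<^sup>2 else e w)"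
      using insert.hyps(2) by (auto simp: E_def fun_eq_iff)
    finally show ?thesis .
  qed
  then show ?case using h(1) by blast
qed

context function_algebra
begin

lemma substitute_polynomials:
  assumes "f \<in> poly_in" and \<sigma>: "\<And>v j. (\<lambda>x. coeff (\<sigma> v x) j) \<in> C"
  shows "\<exists>p. (\<forall>j. (\<lambda>x. coeff (p x) j) \<in> C) \<and> (\<forall>x y. poly (p x) y = f (\<lambda>v. poly (\<sigma> v x) y))"
  using assms(1)
proof induction
  case (const_in c)
  have "(\<lambda>x. coeff [:c:] j) \<in> C" for j by (rule local.const)
  then show ?case by (intro exI[of _ "\<lambda>_. [:c:]"]) auto
next
  case (var_in v)
  then show ?case by (intro exI[of _ "\<sigma> v"]) (simp add: \<sigma>)
next
  case (add_in f g)
  then obtain p q where "\<forall>j. (\<lambda>x. coeff (p x) j) \<in> C" "\<forall>j. (\<lambda>x. coeff (q x) j) \<in> C"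
    "\<forall>x y. poly (p x) y = f (\<lambda>v. poly (\<sigma> v x) y)" "\<forall>x y. poly (q x) y = g (\<lambda>v. poly (\<sigma> v x) y)"
    by blast
  then show ?case
    by (intro exI[of _ "\<lambda>x. p x + q x"]) (auto intro: local.add)
next
  case (mult_in f g)
  then obtain p q where "\<forall>j. (\<lambda>x. coeff (p x) j) \<in> C" "\<forall>j. (\<lambda>x. coeff (q x) j) \<in> C"
    "\<forall>x y. poly (p x) y = f (\<lambda>v. poly (\<sigma> v x) y)" "\<forall>x y. poly (q x) y = g (\<lambda>v. poly (\<sigma> v x) y)"
    by blast
  then show ?case
    by (intro exI[of _ "\<lambda>x. p x * q x"]) (auto simp: coeff_mult intro!: sum local.mult)
qed

end

section \<open>The branch polynomial\<close>

text \<open>The left-hand side of the last equation of the system for the square roots \<open>v\<^sub>i\<close>, at \<open>z = s y\<close>.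
The general scalar type admits the real square roots of the example as well.\<close>

definition phi :: "('n::finite \<Rightarrow> 'a::comm_ring_1) \<Rightarrow> 'a \<Rightarrow> 'a" where
  "phi v z = (1 - of_nat CARD('n) + (\<Sum>i\<in>UNIV. v i))\<^sup>2 - 1 + z"

text \<open>The relation determines \<open>p\<close>, and mentions the square roots \<open>r\<close> only through an arbitrary choice,
since another choice permutes the factors.\<close>

definition branch_poly :: "('n::finite \<Rightarrow> complex) \<Rightarrow> complex \<Rightarrow> complex poly \<Rightarrow> bool" where
  "branch_poly k s p \<longleftrightarrow> (\<forall>y r. (\<forall>i. (r i)\<^sup>2 = 1 - y * k i) \<longrightarrow>
     poly p y = (\<Prod>B\<in>UNIV. phi (flip B r) (s * y)))"

text \<open>The existence of \<open>p\<close> pointwise would not suffice: genericity needs the coefficients of \<open>p\<close> to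
depend on the parameters as functions in \<open>C\<close>.  The norm over sign changes is therefore
formed once, in indeterminates for the square roots and for \<open>s y\<close>, and then evaluated.\<close>

lemma (in function_algebra) branch_poly_exists:
  fixes k :: "'n::finite \<Rightarrow> 'a \<Rightarrow> complex"
  assumes "\<And>i. k i \<in> C" "s \<in> C"
  shows "\<exists>p. (\<forall>j. (\<lambda>x. coeff (p x) j) \<in> C) \<and> (\<forall>x. branch_poly (\<lambda>i. k i x) (s x) (p x))"
proof -
  define f :: "('n option \<Rightarrow> complex) \<Rightarrow> complex" where
    "f = (\<lambda>e. (1 - of_nat CARD('n) + (\<Sum>i\<in>UNIV. e (Some i)))\<^sup>2 - 1 + e None)"
  have "f \<in> poly_in"
    unfolding f_def
    by (intro poly_in.add poly_in.diff poly_in.power poly_in.sum poly_in.const poly_in.var_in)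
  from sign_norm_exists[OF _ this, of "range Some"] obtain g where g: "g \<in> poly_in"
    "\<And>e. (\<Prod>B\<in>Pow (range Some). f (flip B e)) = g (\<lambda>v. if v \<in> range Some then (e v)\<^sup>2 else e v)"
    by auto
  define \<sigma> where "\<sigma> = (\<lambda>v x. case v of None \<Rightarrow> [:0, s x:] | Some i \<Rightarrow> [:1, - k i x:])"
  have "(\<lambda>x. coeff (\<sigma> v x) j) \<in> C" for v j
    by (cases v; cases j; cases "j - 1") (auto simp: \<sigma>_def intro!: const uminus assms)
  from substitute_polynomials[of g \<sigma>, OF g(1) this] obtain p where
    p: "\<forall>j. (\<lambda>x. coeff (p x) j) \<in> C" "\<And>x y. poly (p x) y = g (\<lambda>v. poly (\<sigma> v x) y)" by blast
  have "poly (p x) y = (\<Prod>B\<in>UNIV. phi (flip B r) (s x * y))" if r: "\<forall>i. (r i)\<^sup>2 = 1 - y * k i x" for x y r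
  proof -
    define e where "e = (\<lambda>v. case v of None \<Rightarrow> s x * y | Some i \<Rightarrow> r i)"
    have "(\<lambda>v. if v \<in> range Some then (e v)\<^sup>2 else e v) = (\<lambda>v. poly (\<sigma> v x) y)"
      using r by (auto simp: fun_eq_iff e_def \<sigma>_def split: option.split)
    then have "poly (p x) y = (\<Prod>B\<in>Pow (range Some). f (flip B e))"
      by (simp add: p g(2))
    also have "Pow (range Some) = (\<lambda>B. Some ` B) ` (UNIV :: 'n set set)"
      by (auto simp: image_iff subset_image_iff)
    also have "(\<Prod>B\<in>(\<lambda>B. Some ` B) ` (UNIV :: 'n set set). f (flip B e)) = (\<Prod>B\<in>UNIV. f (flip (Some ` B) e))"
      by (subst prod.reindex) (auto simp: inj_on_def)
    also have "\<dots> = (\<Prod>B\<in>UNIV. phi (flip B r) (s x * y))"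
    proof (intro prod.cong refl)
      fix B :: "'n set"
      have "(\<Sum>i\<in>UNIV. flip (Some ` B) e (Some i)) = (\<Sum>i\<in>UNIV. flip B r i)"
        by (intro sum.cong) (auto simp: flip_def e_def)
      moreover have "flip (Some ` B) e None = s x * y" by (auto simp: flip_def e_def)
      ultimately show "f (flip (Some ` B) e) = phi (flip B r) (s x * y)"
        by (simp add: f_def phi_def)
    qed
    finally show ?thesis .
  qed
  then show ?thesis using p(1) unfolding branch_poly_def by blast
qed

text \<open>A square root of \<open>1 - y k\<^sub>i\<close> is of size \<open>\<surd>\<bar>y\<bar>\<close> at infinity, and \<open>phi\<close> is quadratic in the roots.\<close>

lemma phi_bound_large:
  fixes k :: "'n::finite \<Rightarrow> complex"
  obtains c where "c > 0" and
    "\<And>y r. (\<forall>i. (r i)\<^sup>2 = 1 - y * k i) \<Longrightarrow> 1 \<le> norm y \<Longrightarrow> norm (phi r (s * y)) \<le> c * norm y"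
proof
  define a where "a = 1 + real CARD('n) + (\<Sum>i\<in>UNIV. sqrt (1 + norm (k i)))"
  define c where "c = a\<^sup>2 + 1 + norm s"
  show "c > 0" unfolding c_def by (intro add_pos_nonneg add_nonneg_pos) auto
  fix y :: complex and r :: "'n \<Rightarrow> complex"
  assume r: "\<forall>i. (r i)\<^sup>2 = 1 - y * k i" and y: "1 \<le> norm y"
  have y1: "1 \<le> sqrt (norm y)" using y by simp
  have a0: "a \<ge> 1" unfolding a_def by (auto intro!: add_nonneg_nonneg sum_nonneg)
  have ri: "norm (r i) \<le> sqrt (1 + norm (k i)) * sqrt (norm y)" for i
  proof -
    have "(norm (r i))\<^sup>2 = norm (1 - y * k i)" using r by (metis norm_power)
    also have "\<dots> \<le> 1 + norm y * norm (k i)" by (metis norm_mult norm_one norm_triangle_ineq4)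
    also have "\<dots> \<le> (1 + norm (k i)) * norm y" using y by (simp add: algebra_simps)
    finally have "norm (r i) \<le> sqrt ((1 + norm (k i)) * norm y)" by (rule real_le_rsqrt)
    then show ?thesis by (simp add: real_sqrt_mult)
  qed
  have "norm (1 - of_nat CARD('n) + (\<Sum>i\<in>UNIV. r i)) \<le> norm (1 - of_nat CARD('n) :: complex) + norm (\<Sum>i\<in>UNIV. r i)"
    by (rule norm_triangle_ineq)
  also have "norm (1 - of_nat CARD('n) :: complex) \<le> 1 + real CARD('n)"
    by (metis norm_of_nat norm_one norm_triangle_ineq4)
  also have "norm (\<Sum>i\<in>UNIV. r i) \<le> (\<Sum>i\<in>UNIV. sqrt (1 + norm (k i)) * sqrt (norm y))"
    by (intro sum_norm_le ri)
  also have "1 + real CARD('n) + (\<Sum>i\<in>UNIV. sqrt (1 + norm (k i)) * sqrt (norm y)) \<le> a * sqrt (norm y)"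
    using mult_left_mono[OF y1, of "1 + real CARD('n)"]
    by (simp add: a_def algebra_simps sum_distrib_left)
  finally have "norm (1 - of_nat CARD('n) + (\<Sum>i\<in>UNIV. r i)) ^ 2 \<le> (a * sqrt (norm y)) ^ 2"
    by (intro power_mono) auto
  then have 1: "norm ((1 - of_nat CARD('n) + (\<Sum>i\<in>UNIV. r i))\<^sup>2) \<le> a\<^sup>2 * norm y"
    by (simp add: norm_power power_mult_distrib)
  have "norm (phi r (s * y)) \<le> norm ((1 - of_nat CARD('n) + (\<Sum>i\<in>UNIV. r i))\<^sup>2) + 1 + norm (s * y)"
    unfolding phi_def by (metis (no_types, lifting) add_right_mono norm_one norm_triangle_ineq norm_triangle_ineq4 order_trans)
  also have "\<dots> \<le> a\<^sup>2 * norm y + norm y + norm s * norm y"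
    using 1 y by (simp add: norm_mult)
  also have "\<dots> = c * norm y" by (simp add: c_def algebra_simps)
  finally show "norm (phi r (s * y)) \<le> c * norm y" .
qed

text \<open>The principal root satisfies \<open>(\<surd>(1 + z) - 1) (\<surd>(1 + z) + 1) = z\<close>, and its real part is nonnegative.\<close>

lemma norm_csqrt_minus_1: "norm (csqrt (1 + z) - 1) \<le> norm z"
proof -
  have "(csqrt (1 + z) - 1) * (csqrt (1 + z) + 1) = z"
    by (simp add: algebra_simps flip: power2_eq_square)
  moreover have "1 \<le> norm (csqrt (1 + z) + 1)"
    using csqrt_principal[of "1 + z"] complex_Re_le_cmod[of "csqrt (1 + z) + 1"]
    unfolding plus_complex.sel one_complex.sel by linarith
  ultimately show ?thesis
    by (metis mult.commute mult_left_mono mult.right_neutral norm_ge_zero norm_mult)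
qed

text \<open>With \<open>w = 1 - n + \<Sum> \<plusminus>\<surd>(1 - y k\<^sub>i)\<close>, the factor is \<open>(w - 1) (w + 1) + s y\<close>, and \<open>w\<close> differs from
\<open>1 - 2 card B\<close> by \<open>O(y)\<close>.  So \<open>w - 1\<close> is small if \<open>B\<close> is empty, and \<open>w + 1\<close> if it is a singleton.\<close>

lemma phi_bound_small:
  fixes k :: "'n::finite \<Rightarrow> complex"
  obtains c where "c > 0" and
    "\<And>y B. norm y \<le> 1 \<Longrightarrow> norm (phi (flip B (\<lambda>i. csqrt (1 - y * k i))) (s * y)) \<le> c"
    "\<And>y B. norm y \<le> 1 \<Longrightarrow> card B \<le> 1 \<Longrightarrow>
       norm (phi (flip B (\<lambda>i. csqrt (1 - y * k i))) (s * y)) \<le> c * norm y"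
proof
  define b where "b = (\<Sum>i\<in>UNIV. norm (k i))"
  define m where "m = 2 + 2 * real CARD('n) + b"
  define c where "c = m * m + norm s"
  have b0: "b \<ge> 0" by (simp add: b_def sum_nonneg)
  show "c > 0" unfolding c_def m_def using b0 by (intro add_pos_nonneg mult_pos_pos) auto
  fix y :: complex and B :: "'n set"
  assume y: "norm y \<le> 1"
  define r where "r = (\<lambda>i. csqrt (1 - y * k i))"
  define w where "w = 1 - of_nat CARD('n) + (\<Sum>i\<in>UNIV. flip B r i)"
  define e where "e = (\<Sum>i\<in>UNIV. flip B (\<lambda>i. r i - 1) i)"
  have "norm (r i - 1) \<le> norm y * norm (k i)" for i
    using norm_csqrt_minus_1[of "- (y * k i)"] by (simp add: r_def norm_mult)
  then have "norm (flip B (\<lambda>i. r i - 1) i) \<le> norm y * norm (k i)" for i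
    unfolding flip_def by (smt (verit) norm_minus_cancel)
  then have e: "norm e \<le> b * norm y"
    unfolding e_def b_def by (intro order_trans[OF sum_norm_le[of UNIV _ "\<lambda>i. norm y * norm (k i)"]])
      (auto simp: sum_distrib_left mult.commute)
  have "(\<Sum>i\<in>UNIV. flip B r i) = (\<Sum>i\<in>UNIV. flip B (\<lambda>i. r i - 1) i + flip B (\<lambda>i. 1) i)"
    by (intro sum.cong) (auto simp: flip_def)
  also have "\<dots> = e + (\<Sum>i\<in>UNIV. flip B (\<lambda>i. 1) i)" by (simp add: e_def sum.distrib)
  also have "(\<Sum>i\<in>UNIV. flip B (\<lambda>i. 1::complex) i) = of_nat CARD('n) - 2 * of_nat (card B)"
    by (simp add: flip_def sum.If_cases Compl_eq_Diff_UNIV card_Diff_subset of_nat_diff card_mono)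
  finally have w: "w = 1 - 2 * of_nat (card B) + e" by (simp add: w_def)
  have cB: "card B \<le> CARD('n)" by (simp add: card_mono)
  have e1: "norm e \<le> b" using e b0 y mult_left_mono[OF y b0] by simp
  have w_m: "norm (w - 1) \<le> m" "norm (w + 1) \<le> m"
  proof -
    have "norm (w - 1) = norm (- 2 * of_nat (card B) + e)" by (simp add: w)
    also have "\<dots> \<le> 2 * real (card B) + norm e"
      by (rule order_trans[OF norm_triangle_ineq]) (simp add: norm_mult)
    finally show "norm (w - 1) \<le> m" using cB e1 by (simp add: m_def)
    have "norm (w + 1) = norm (2 - 2 * of_nat (card B) + e)" by (simp add: w algebra_simps)
    also have "\<dots> \<le> norm (2 - 2 * of_nat (card B) :: complex) + norm e" by (rule norm_triangle_ineq)
    also have "norm (2 - 2 * of_nat (card B) :: complex) \<le> 2 + 2 * real (card B)"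
      by (rule order_trans[OF norm_triangle_ineq4]) (simp add: norm_mult)
    finally show "norm (w + 1) \<le> m" using cB e1 by (simp add: m_def)
  qed
  have phi: "phi (flip B r) (s * y) = (w - 1) * (w + 1) + s * y"
    by (simp add: phi_def w_def power2_eq_square algebra_simps)
  have m0: "m \<ge> 0" "b \<le> m" using b0 by (auto simp: m_def)
  have "norm (phi (flip B r) (s * y)) \<le> norm (w - 1) * norm (w + 1) + norm s * norm y"
    unfolding phi by (rule order_trans[OF norm_triangle_ineq]) (simp add: norm_mult)
  note le = this
  also have "\<dots> \<le> m * m + norm s * 1"
    using w_m m0 y by (intro add_mono mult_mono) auto
  finally show "norm (phi (flip B (\<lambda>i. csqrt (1 - y * k i))) (s * y)) \<le> c"
    by (simp add: c_def r_def)
  assume "card B \<le> 1"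
  then consider "card B = 0" | "card B = 1" by linarith
  then have "norm (w - 1) * norm (w + 1) \<le> m * (b * norm y)"
  proof cases
    case 1
    then have "norm (w - 1) = norm e" by (simp add: w)
    then show ?thesis using e w_m m0 b0 by (subst mult.commute) (auto intro!: mult_mono)
  next
    case 2
    then have "norm (w + 1) = norm e" by (simp add: w)
    then show ?thesis using e w_m m0 b0 by (auto intro!: mult_mono)
  qed
  also have "\<dots> \<le> m * (m * norm y)" using m0 by (intro mult_left_mono mult_right_mono) auto
  finally show "norm (phi (flip B (\<lambda>i. csqrt (1 - y * k i))) (s * y)) \<le> c * norm y"
    using le by (simp add: c_def r_def algebra_simps)
qed

lemma norm_poly_0_le:
  fixes p :: "complex poly"
  assumes "\<And>y. norm y \<le> 1 \<Longrightarrow> y \<noteq> 0 \<Longrightarrow> norm (poly p y) \<le> c * norm y ^ m"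
  shows "norm (poly p 0) \<le> c * 0 ^ m"
proof (rule tendsto_le[of "at (0::complex)"])
  show "((\<lambda>y::complex. c * norm y ^ m) \<longlongrightarrow> c * 0 ^ m) (at 0)"
    by (rule tendsto_eq_intros refl | simp)+
  show "((\<lambda>y. norm (poly p y)) \<longlongrightarrow> norm (poly p 0)) (at 0)"
    by (intro tendsto_intros)
  show "\<forall>\<^sub>F y in at (0::complex). norm (poly p y) \<le> c * norm y ^ m"
    unfolding eventually_at by (rule exI[of _ 1]) (auto intro: assms)
qed simp

lemma monom_dvd_of_bound:
  fixes p :: "complex poly"
  assumes "\<And>y. norm y \<le> 1 \<Longrightarrow> norm (poly p y) \<le> c * norm y ^ m"
  shows "monom 1 m dvd p"
  using assms
proof (induction m arbitrary: p)
  case (Suc m)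
  have "poly p 0 = 0" using Suc.prems[of 0] by simp
  then obtain q where q: "p = [:0, 1:] * q"
    using poly_eq_0_iff_dvd[of p 0] by (auto elim: dvdE)
  have *: "norm (poly q y) \<le> c * norm y ^ m" if "norm y \<le> 1" "y \<noteq> 0" for y
  proof -
    have "norm y * norm (poly q y) \<le> norm y * (c * norm y ^ m)"
      using Suc.prems[OF that(1)] by (simp add: q norm_mult algebra_simps)
    then show ?thesis using that(2) by simp
  qed
  have "norm (poly q y) \<le> c * norm y ^ m" if "norm y \<le> 1" for y
  proof (cases "y = 0")
    case True
    then show ?thesis using norm_poly_0_le[of q c m] * by simp
  qed (use * that in auto)
  then have "monom 1 m dvd q" by (rule Suc.IH)
  then obtain t where "q = monom 1 m * t" by (elim dvdE)
  then have "p = monom 1 (Suc m) * t" unfolding q by (simp add: monom_Suc)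
  then show ?case by simp
qed (auto simp: monom_0 one_pCons[symmetric])

text \<open>The reflected polynomial would vanish at \<open>0\<close>, where its value is the leading coefficient.\<close>

lemma degree_le_of_bound:
  fixes p :: "complex poly"
  assumes "\<And>y. 1 \<le> norm y \<Longrightarrow> norm (poly p y) \<le> c * norm y ^ m"
  shows "degree p \<le> m"
proof (rule ccontr)
  assume "\<not> degree p \<le> m"
  then obtain l where l: "degree p = m + l" "l > 0" by (metis less_imp_add_positive not_le)
  have *: "norm (poly (reflect_poly p) y) \<le> c * norm y ^ l" if "norm y \<le> 1" "y \<noteq> 0" for y
  proof -
    have "norm (poly (reflect_poly p) y) = norm y ^ (m + l) * norm (poly p (inverse y))"
      using that by (simp add: poly_reflect_poly_nz l norm_mult norm_power)
    also have "\<dots> \<le> norm y ^ (m + l) * (c * norm (inverse y) ^ m)"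
      using that by (intro mult_left_mono assms) (auto simp: norm_inverse one_le_inverse)
    also have "\<dots> = c * norm y ^ l"
      using that by (simp add: norm_inverse power_add power_inverse)
    finally show ?thesis .
  qed
  then have "norm (poly (reflect_poly p) 0) \<le> c * 0 ^ l"
    by (intro norm_poly_0_le)
  then have "lead_coeff p = 0" using l by (simp add: zero_power)
  then have "p = 0" by simp
  then show False using l by simp
qed

lemma card_sets_card_le_1: "card {B :: 'n::finite set. card B \<le> 1} = CARD('n) + 1"
proof -
  have "{B :: 'n set. card B \<le> 1} = insert {} (range (\<lambda>i. {i}))"
    by (auto simp: le_Suc_eq card_1_singleton_iff)
  moreover have "card (range (\<lambda>i::'n. {i})) = CARD('n)" by (simp add: card_image)
  ultimately show ?thesis by (simp add: card_insert_if image_iff)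
qed

lemma branch_poly_degree_le:
  assumes "branch_poly (k :: 'n::finite \<Rightarrow> complex) s p"
  shows "degree p \<le> 2 ^ CARD('n)"
proof -
  obtain c where c: "c > 0"
    "\<And>y r. (\<forall>i. (r i)\<^sup>2 = 1 - y * k i) \<Longrightarrow> 1 \<le> norm y \<Longrightarrow> norm (phi r (s * y)) \<le> c * norm y"
    by (rule phi_bound_large[of k s]) blast
  show ?thesis
  proof (rule degree_le_of_bound)
    fix y :: complex assume y: "1 \<le> norm y"
    define r where "r = (\<lambda>i. csqrt (1 - y * k i))"
    have r: "\<forall>i. (r i)\<^sup>2 = 1 - y * k i" by (simp add: r_def)
    then have "norm (poly p y) = (\<Prod>B\<in>UNIV. norm (phi (flip B r) (s * y)))"
      using assms by (simp add: branch_poly_def prod_norm)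
    also have "\<dots> \<le> (\<Prod>B\<in>(UNIV :: 'n set set). c * norm y)"
      using r by (intro prod_mono conjI c(2) y) (auto simp: flip_def)
    also have "\<dots> = c ^ (2 ^ CARD('n)) * norm y ^ (2 ^ CARD('n))"
      by (simp add: card_UNIV_set power_mult_distrib)
    finally show "norm (poly p y) \<le> c ^ (2 ^ CARD('n)) * norm y ^ (2 ^ CARD('n))" .
  qed
qed

text \<open>The sign changes on at most one index are \<open>n + 1\<close> in number, and their factors are \<open>O(y)\<close>.\<close>

lemma branch_poly_order_ge:
  assumes "branch_poly (k :: 'n::finite \<Rightarrow> complex) s p"
  shows "monom 1 (CARD('n) + 1) dvd p"
proof -
  obtain c where c: "c > 0"
    "\<And>y B. norm y \<le> 1 \<Longrightarrow> norm (phi (flip B (\<lambda>i. csqrt (1 - y * k i))) (s * y)) \<le> c"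
    "\<And>y B. norm y \<le> 1 \<Longrightarrow> card B \<le> 1 \<Longrightarrow>
       norm (phi (flip B (\<lambda>i. csqrt (1 - y * k i))) (s * y)) \<le> c * norm y"
    by (rule phi_bound_small[of k s]) blast
  show ?thesis
  proof (rule monom_dvd_of_bound)
    fix y :: complex assume y: "norm y \<le> 1"
    define r where "r = (\<lambda>i. csqrt (1 - y * k i))"
    define D where "D = {B :: 'n set. card B \<le> 1}"
    have r: "\<forall>i. (r i)\<^sup>2 = 1 - y * k i" by (simp add: r_def)
    then have "norm (poly p y) = (\<Prod>B\<in>UNIV. norm (phi (flip B r) (s * y)))"
      using assms by (simp add: branch_poly_def prod_norm)
    also have "\<dots> \<le> (\<Prod>B\<in>(UNIV :: 'n set set). c * (if B \<in> D then norm y else 1))"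
      using c y by (intro prod_mono conjI) (auto simp: r_def D_def)
    also have "\<dots> = c ^ (2 ^ CARD('n)) * norm y ^ card D"
      by (simp add: card_UNIV_set prod.distrib prod.If_cases)
    finally show "norm (poly p y) \<le> c ^ (2 ^ CARD('n)) * norm y ^ (CARD('n) + 1)"
      unfolding D_def card_sets_card_le_1 .
  qed
qed

text \<open>Near \<open>y0\<close> the square roots extend to holomorphic functions \<open>r\<close> of \<open>y\<close> with \<open>r y0 = v\<close>, and \<open>p\<close> is the
product of the holomorphic factors \<open>F B\<close> for the sets \<open>B\<close> of sign changes.  The factor \<open>F {}\<close> vanishes at \<open>y0\<close>,
so the derivative of the product at \<open>y0\<close> is \<open>F' {}\<close> times the product of the other factors.  As the
root \<open>y0\<close> of \<open>p\<close> is simple, none of these numbers can be zero.\<close>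

lemma branch_poly_simple_root:
  fixes v :: "'n::finite \<Rightarrow> complex"
  assumes p: "branch_poly k s p"
    and v: "\<And>i. (v i)\<^sup>2 = 1 - y0 * k i" "\<And>i. v i \<noteq> 0"
    and root: "phi v (s * y0) = 0"
    and simple: "poly (pderiv p) y0 \<noteq> 0"
  shows "s \<noteq> (1 - of_nat CARD('n) + (\<Sum>i\<in>UNIV. v i)) * (\<Sum>i\<in>UNIV. k i / v i)"
    and "\<And>v'. (\<And>i. (v' i)\<^sup>2 = 1 - y0 * k i) \<Longrightarrow> phi v' (s * y0) = 0 \<Longrightarrow> v' = v"
proof -
  \<comment> \<open>Normalized by \<open>v\<close> so that the argument of the principal root is \<open>1\<close> at \<open>y0\<close>, away from the branch cut.\<close>
  define r where "r = (\<lambda>y i. v i * csqrt ((1 - y * k i) / (v i)\<^sup>2))"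
  define F where "F = (\<lambda>B y. phi (flip B (r y)) (s * y))"
  define w where "w = (\<lambda>B. 1 - of_nat CARD('n) + (\<Sum>i\<in>UNIV. flip B v i))"
  define F' where "F' = (\<lambda>B. 2 * w B * (\<Sum>i\<in>UNIV. flip B (\<lambda>i. - k i / (2 * v i)) i) + s)"
  have r0: "r y0 = v"
    using v(2) by (auto simp: r_def fun_eq_iff v(1)[symmetric])
  have r_sq: "\<forall>i. (r y i)\<^sup>2 = 1 - y * k i" for y
    using v(2) by (simp add: r_def power_mult_distrib)
  have p_eq: "poly p y = (\<Prod>B\<in>UNIV. F B y)" for y
    using p r_sq[of y] unfolding branch_poly_def F_def by blast
  have dr: "((\<lambda>y. r y i) has_field_derivative - k i / (2 * v i)) (at y0)" for i
  proof -
    have 1: "(1 - y0 * k i) / (v i)\<^sup>2 = 1" using v by (simp add: v(1)[symmetric])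
    have "((\<lambda>y. (1 - y * k i) / (v i)\<^sup>2) has_field_derivative (0 - 1 * k i) / (v i)\<^sup>2) (at y0)"
      by (intro DERIV_cdivide DERIV_diff DERIV_const DERIV_cmult_right DERIV_ident)
    from has_field_derivative_csqrt'[OF this] 1
    have "((\<lambda>y. csqrt ((1 - y * k i) / (v i)\<^sup>2)) has_field_derivative - k i / (v i)\<^sup>2 / 2) (at y0)"
      by simp
    from DERIV_cmult[OF this, of "v i"] v(2)[of i] show ?thesis
      by (simp add: r_def power2_eq_square mult.commute)
  qed
  have dflip: "((\<lambda>y. flip B (r y) i) has_field_derivative flip B (\<lambda>i. - k i / (2 * v i)) i) (at y0)" for B i
    using dr[of i] DERIV_minus[OF dr[of i]] by (auto simp: flip_def)
  have dF: "(F B has_field_derivative F' B) (at y0)" for B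
    unfolding F_def phi_def
    by (rule derivative_eq_intros dflip refl)+ (simp add: F'_def w_def r0)
  have "((\<lambda>y. \<Prod>B\<in>UNIV. F B y) has_field_derivative
      (\<Sum>B\<in>UNIV. F' B * (\<Prod>B'\<in>UNIV - {B}. F B' y0))) (at y0)"
    by (rule has_field_derivative_prod) (rule dF)
  then have "(poly p has_field_derivative
      (\<Sum>B\<in>UNIV. F' B * (\<Prod>B'\<in>UNIV - {B}. F B' y0))) (at y0)"
    by (simp add: p_eq[symmetric])
  then have "poly (pderiv p) y0 = (\<Sum>B\<in>UNIV. F' B * (\<Prod>B'\<in>UNIV - {B}. F B' y0))"
    by (rule DERIV_unique[OF poly_DERIV])
  also have "\<dots> = (\<Sum>B\<in>{{}}. F' B * (\<Prod>B'\<in>UNIV - {B}. F B' y0))"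
  proof (rule sum.mono_neutral_right)
    show "\<forall>B\<in>UNIV - {{}}. F' B * (\<Prod>B'\<in>UNIV - {B}. F B' y0) = 0"
    proof
      fix B :: "'n set" assume "B \<in> UNIV - {{}}"
      moreover have "F {} y0 = 0" using root by (simp add: F_def r0 flip_def)
      ultimately have "(\<Prod>B'\<in>UNIV - {B}. F B' y0) = 0" by (intro prod_zero) auto
      then show "F' B * (\<Prod>B'\<in>UNIV - {B}. F B' y0) = 0" by simp
    qed
  qed auto
  finally have nz: "F' {} \<noteq> 0" "\<And>B. B \<noteq> {} \<Longrightarrow> F B y0 \<noteq> 0"
    using simple by auto
  have "F' {} = s - (1 - of_nat CARD('n) + (\<Sum>i\<in>UNIV. v i)) * (\<Sum>i\<in>UNIV. k i / v i)"
  proof -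
    have "(\<Sum>i\<in>UNIV. flip {} (\<lambda>i. - k i / (2 * v i)) i) = - (1/2) * (\<Sum>i\<in>UNIV. k i / v i)"
      unfolding sum_distrib_left by (intro sum.cong) (auto simp: flip_def)
    then show ?thesis by (simp add: F'_def w_def flip_def)
  qed
  then show "s \<noteq> (1 - of_nat CARD('n) + (\<Sum>i\<in>UNIV. v i)) * (\<Sum>i\<in>UNIV. k i / v i)"
    using nz(1) by auto
  show "v' = v" if v': "\<And>i. (v' i)\<^sup>2 = 1 - y0 * k i" "phi v' (s * y0) = 0" for v'
  proof -
    have "v' i = v i \<or> v' i = - v i" for i
      using v(1)[of i] v'(1)[of i] by (metis power2_eq_iff)
    then have *: "v' = flip {i. v' i \<noteq> v i} v" by (auto simp: flip_def fun_eq_iff)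
    then have "F {i. v' i \<noteq> v i} y0 = 0" using v'(2) by (simp add: F_def r0)
    then have "{i. v' i \<noteq> v i} = {}" using nz(2)[of "{i. v' i \<noteq> v i}"] by argo
    then show ?thesis by (auto simp: fun_eq_iff)
  qed
qed

section \<open>Parameters with many roots\<close>

text \<open>Powers of two: their subset sums are distinct by uniqueness of the binary expansion.\<close>

lemma distinct_subset_sums:
  obtains k :: "'n::finite \<Rightarrow> real" where "\<And>i. k i > 0" "inj (\<lambda>B. \<Sum>i\<in>B. k i)"
proof -
  obtain h :: "'n \<Rightarrow> nat" where h: "inj h"
    using finite_imp_inj_to_nat_seg[of "UNIV :: 'n set"] by auto
  have "inj (\<lambda>B. \<Sum>i\<in>B. 2 ^ h i :: real)"
  proof (rule injI)
    fix A B :: "'n set"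
    have "(\<Sum>i\<in>A. 2 ^ h i :: real) = real (set_encode (h ` A))" for A
      unfolding set_encode_def using h by (subst sum.reindex) (auto simp: inj_on_def)
    moreover assume "(\<Sum>i\<in>A. 2 ^ h i :: real) = (\<Sum>i\<in>B. 2 ^ h i)"
    ultimately have "set_encode (h ` A) = set_encode (h ` B)" by simp
    then have "h ` A = h ` B" by (subst (asm) set_encode_eq) auto
    then show "A = B" using h by (simp add: inj_image_eq_iff)
  qed
  then show ?thesis by (intro that[of "\<lambda>i. 2 ^ h i"]) auto
qed

lemma phi_of_real: "phi (flip B (\<lambda>i. complex_of_real (r i))) (of_real z) = of_real (phi (flip B r) z)"
proof -
  have "(\<Sum>i\<in>UNIV. flip B (\<lambda>i. complex_of_real (r i)) i) = of_real (\<Sum>i\<in>UNIV. flip B r i)"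
    unfolding of_real_sum by (intro sum.cong) (auto simp: flip_def)
  then show ?thesis by (simp add: phi_def)
qed

lemma card_sets_card_ge_2:
  "card {B :: 'n::finite set. 2 \<le> card B} = 2 ^ CARD('n) - CARD('n) - 1"
proof -
  have "{B :: 'n set. 2 \<le> card B} = UNIV - {B. card B \<le> 1}" by auto
  then have "card {B :: 'n set. 2 \<le> card B} = card (UNIV :: 'n set set) - card {B :: 'n set. card B \<le> 1}"
    by (simp add: card_Diff_subset)
  then show ?thesis by (simp add: card_sets_card_le_1[simplified])
qed

text \<open>For \<open>y \<le> 0\<close> and \<open>k > 0\<close> the square roots are real, and so is \<open>w\<close>.  For a set \<open>B\<close> of \<open>b\<close> minus signs
substitute \<open>y = z / s\<close>: for large \<open>s\<close> the factor is close to \<open>4 b (b - 1) + z\<close>, uniformly for bounded \<open>z\<close>, and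
the intermediate value theorem gives a root with \<open>z\<close> within distance \<open>1\<close> of \<open>-4 b (b - 1)\<close>.
Roots for different \<open>b\<close> are therefore different.  If a root belonged to two different sets of the
same size \<open>b \<ge> 2\<close>, then \<open>w\<close> would agree on them up to sign; both values are close to
\<open>1 - 2 b < 0\<close>, so they would be equal.  But the derivatives of \<open>w\<close> at \<open>y = 0\<close> differ by the difference
of the sums of \<open>k\<close> over the two sets.  The value at \<open>-1\<close> shows that the polynomial is not zero, as all
factors are negative there.\<close>

lemma branch_poly_many_roots:
  obtains k :: "'n::finite \<Rightarrow> real" and b :: real where "\<And>i. k i > 0" "b > 0"
    "\<And>s p. s > b \<Longrightarrow> branch_poly (\<lambda>i. complex_of_real (k i)) (of_real s) p \<Longrightarrow>
       poly p (-1) \<noteq> 0 \<and>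
       (\<exists>Y. Y \<subseteq> {..<0} \<and> finite Y \<and> card Y = 2 ^ CARD('n) - CARD('n) - 1 \<and> (\<forall>y\<in>Y. poly p (of_real y) = 0))"
proof -
  obtain k :: "'n \<Rightarrow> real" where k: "\<And>i. k i > 0" "inj (\<lambda>B. \<Sum>i\<in>B. k i)"
    by (rule distinct_subset_sums) blast
  define r where "r = (\<lambda>y i. sqrt (1 - y * k i))"
  define W where "W = (\<lambda>B y. 1 - real CARD('n) + (\<Sum>i\<in>UNIV. flip B (r y) i))"
  have r_sq: "(r y i)\<^sup>2 = 1 - y * k i" if "y \<le> 0" for y i
  proof -
    have "y * k i \<le> 0" using that k(1)[of i] by (intro mult_nonpos_nonneg) auto
    then show ?thesis by (simp add: r_def)
  qed
  have phi_W: "phi (flip B (r y)) z = (W B y)\<^sup>2 - 1 + z" for B y z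
    by (simp add: phi_def W_def)
  have W_sum: "W B y = 1 - real CARD('n) + (\<Sum>i\<in>UNIV. r y i) - 2 * (\<Sum>i\<in>B. r y i)" for B y
  proof -
    have "(\<Sum>i\<in>UNIV. flip B (r y) i) = (\<Sum>i\<in>UNIV. r y i - 2 * (if i \<in> B then r y i else 0))"
      by (intro sum.cong) (auto simp: flip_def)
    then show ?thesis
      by (simp add: W_def sum_subtractf sum_distrib_left[symmetric] sum.If_cases)
  qed
  have W_0: "W B 0 = 1 - 2 * real (card B)" for B by (simp add: W_sum r_def)
  have cont: "continuous_on {..0} (W B)" for B
    unfolding W_sum r_def by (intro continuous_intros)
  have lim: "(W B \<longlongrightarrow> 1 - 2 * real (card B)) (at_left 0)" for B
  proof -
    have "isCont (\<lambda>y. 1 - real CARD('n) + (\<Sum>i\<in>UNIV. r y i) - 2 * (\<Sum>i\<in>B. r y i)) 0"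
      unfolding r_def by (intro continuous_intros)
    then have "isCont (W B) 0" by (simp add: W_sum[abs_def])
    then have "(W B \<longlongrightarrow> W B 0) (at 0)" by (simp add: isCont_def)
    then show ?thesis unfolding W_0 by (rule filterlim_mono) (auto simp: at_within_le_at)
  qed
  have E1: "\<forall>\<^sub>F y in at_left 0. W B y < 0" if "B \<noteq> {}" for B
  proof (rule order_tendstoD(2)[OF lim])
    have "1 \<le> card B" using that by (simp add: Suc_leI card_gt_0_iff)
    then show "1 - 2 * real (card B) < 0" by simp
  qed
  have E2: "\<forall>\<^sub>F y in at_left 0. W B y \<noteq> W A y" if "card A = card B" "A \<noteq> B" for A B
  proof -
    define l where "l = (\<Sum>i\<in>B. k i) - (\<Sum>i\<in>A. k i)"
    define f where "f = (\<lambda>y. 2 * (\<Sum>i\<in>A. r y i) - 2 * (\<Sum>i\<in>B. r y i))"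
    have dr: "((\<lambda>y. r y i) has_real_derivative - k i / 2) (at 0)" for i
      unfolding r_def by (rule derivative_eq_intros refl | simp)+
    have "(f has_real_derivative 2 * (\<Sum>i\<in>A. - k i / 2) - 2 * (\<Sum>i\<in>B. - k i / 2)) (at 0)"
      unfolding f_def by (intro DERIV_diff DERIV_cmult DERIV_sum dr)
    also have "2 * (\<Sum>i\<in>A. - k i / 2) - 2 * (\<Sum>i\<in>B. - k i / 2) = l"
      by (simp add: l_def sum_negf sum_divide_distrib[symmetric])
    finally have df: "DERIV f 0 :> l" .
    have "l \<noteq> 0" using k(2) that(2) by (auto simp: l_def inj_def)
    then have "\<exists>d>0. \<forall>h>0. h < d \<longrightarrow> f (0 - h) \<noteq> f 0"
      using DERIV_pos_inc_left[OF df] DERIV_neg_dec_left[OF df] by (metis less_irrefl linorder_neqE_linordered_idom)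
    then obtain d where d: "d > 0" "\<And>h. h > 0 \<Longrightarrow> h < d \<Longrightarrow> f (0 - h) \<noteq> f 0" by blast
    have "f 0 = 0" using that by (simp add: f_def r_def)
    then have "f y \<noteq> 0" if "- d < y" "y < 0" for y
      using d(2)[of "- y"] that by simp
    then show ?thesis
      unfolding eventually_at_left_field using d(1)
      by (intro exI[of _ "- d"]) (force simp: f_def W_sum)
  qed
  have E1': "\<forall>\<^sub>F y in at_left 0. B \<noteq> {} \<longrightarrow> W B y < 0" for B
    using E1[of B] by (cases "B = {}") simp_all
  have E2': "\<forall>\<^sub>F y in at_left 0. card A = card B \<longrightarrow> A \<noteq> B \<longrightarrow> W B y \<noteq> W A y" for A B
    using E2[of A B] by (cases "card A = card B \<and> A \<noteq> B") auto
  have E3: "\<forall>\<^sub>F y in at_left 0. \<bar>(W B y)\<^sup>2 - (1 - 2 * real (card B))\<^sup>2\<bar> < 1" for B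
  proof -
    have "((\<lambda>y. (W B y)\<^sup>2) \<longlongrightarrow> (1 - 2 * real (card B))\<^sup>2) (at_left 0)"
      by (intro tendsto_intros lim)
    from tendstoD[OF this, of 1] show ?thesis by (simp add: dist_real_def)
  qed
  have "\<forall>\<^sub>F y in at_left 0. (\<forall>B. B \<noteq> {} \<longrightarrow> W B y < 0) \<and>
      (\<forall>A B. card A = card B \<longrightarrow> A \<noteq> B \<longrightarrow> W B y \<noteq> W A y) \<and>
      (\<forall>B. \<bar>(W B y)\<^sup>2 - (1 - 2 * real (card B))\<^sup>2\<bar> < 1)"
    by (intro eventually_conj eventually_all_finite E1' E2' E3)
  then obtain \<delta>' where "\<delta>' < 0" and \<delta>': "\<And>y. \<delta>' < y \<Longrightarrow> y < 0 \<Longrightarrow> (\<forall>B. B \<noteq> {} \<longrightarrow> W B y < 0) \<and>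
      (\<forall>A B. card A = card B \<longrightarrow> A \<noteq> B \<longrightarrow> W B y \<noteq> W A y) \<and>
      (\<forall>B. \<bar>(W B y)\<^sup>2 - (1 - 2 * real (card B))\<^sup>2\<bar> < 1)"
    unfolding eventually_at_left_field by blast
  define \<delta> where "\<delta> = - \<delta>'"
  have \<delta>: "\<delta> > 0" using \<open>\<delta>' < 0\<close> by (simp add: \<delta>_def)
  \<comment> \<open>All \<open>z\<close> that occur lie between \<open>-m\<close> and \<open>0\<close>, so \<open>s > m / \<delta>\<close> keeps \<open>z / s\<close> in the range of the estimates.\<close>
  define m where "m = 4 * real CARD('n) ^ 2 + 2"
  define b where "b = m / \<delta> + (\<Sum>B\<in>UNIV. (W B (-1))\<^sup>2)"
  have "m > 0" by (simp add: m_def add_nonneg_pos)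
  then have b: "b > 0" "b \<ge> m / \<delta>" "\<And>B. b \<ge> (W B (-1))\<^sup>2"
  proof -
    have s0: "0 \<le> (\<Sum>B\<in>UNIV. (W B (-1))\<^sup>2)" by (intro sum_nonneg) auto
    have m0: "m / \<delta> > 0" using \<open>m > 0\<close> \<delta> by simp
    show "b > 0" "b \<ge> m / \<delta>" using s0 m0 by (auto simp: b_def)
    fix B
    have "(W B (-1))\<^sup>2 \<le> (\<Sum>B\<in>UNIV. (W B (-1))\<^sup>2)" by (rule member_le_sum) auto
    then show "b \<ge> (W B (-1))\<^sup>2" using m0 by (simp add: b_def)
  qed
  show thesis
  proof (rule that[of k b])
    fix s p
    assume s: "s > b" and p: "branch_poly (\<lambda>i. complex_of_real (k i)) (of_real s) p"
    have s0: "s > 0" "m / s < \<delta>"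
    proof -
      show "s > 0" using s b(1) by simp
      have "m \<le> \<delta> * b" using b(2) \<delta> by (simp add: pos_divide_le_eq mult.commute)
      also have "\<dots> < \<delta> * s" using s \<delta> by simp
      finally show "m / s < \<delta>" using \<open>s > 0\<close> by (simp add: pos_divide_less_eq)
    qed
    have poly_p: "poly p (of_real y) = of_real (\<Prod>B\<in>UNIV. (W B y)\<^sup>2 - 1 + s * y)" if "y \<le> 0" for y
    proof -
      have rr: "(complex_of_real (r y i))\<^sup>2 = 1 - of_real y * of_real (k i)" for i
        using r_sq[OF that] by (metis of_real_1 of_real_diff of_real_mult of_real_power)
      have "poly p (of_real y) =
          (\<Prod>B\<in>UNIV. phi (flip B (\<lambda>i. complex_of_real (r y i))) (of_real s * of_real y))"
        by (rule p[unfolded branch_poly_def, rule_format]) (rule rr)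
      also have "\<dots> = (\<Prod>B\<in>UNIV. of_real ((W B y)\<^sup>2 - 1 + s * y))"
        by (intro prod.cong refl) (simp add: phi_of_real flip: of_real_mult phi_W)
      finally show ?thesis by simp
    qed
    have neg1: "(W B (-1))\<^sup>2 - 1 + s * (-1) \<noteq> 0" for B using b(3)[of B] s by simp
    have m1: "(-1::real) \<le> 0" by simp
    have "(\<Prod>B\<in>UNIV. (W B (-1))\<^sup>2 - 1 + s * (-1)) \<noteq> 0" using neg1 by simp
    then have "poly p (of_real (-1)) \<noteq> 0"
      by (simp only: poly_p[OF m1] of_real_eq_0_iff not_False_eq_True)
    \<comment> \<open>The root of the limit equation \<open>(1 - 2 b)\<^sup>2 - 1 + z = 0\<close>.\<close>
    define z where "z = (\<lambda>B :: 'n set. - 4 * real (card B) * (real (card B) - 1))"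
    have ex: "\<exists>y. - \<delta> < y \<and> y < 0 \<and> \<bar>s * y - z B\<bar> \<le> 1 \<and> (W B y)\<^sup>2 - 1 + s * y = 0" if B: "2 \<le> card B" for B
    proof -
      have z_le: "z B + 1 < 0"
      proof -
        have "2 * 1 \<le> real (card B) * (real (card B) - 1)" using B by (intro mult_mono) auto
        then show ?thesis by (simp add: z_def)
      qed
      have z_ge: "- m < z B - 1"
      proof -
        have "real (card B) * (real (card B) - 1) \<le> real CARD('n) * real CARD('n)"
          using B card_mono[of UNIV B] by (intro mult_mono) auto
        then show ?thesis by (simp add: z_def m_def power2_eq_square)
      qed
      have range: "\<delta>' < x / s \<and> x / s < 0" if "z B - 1 \<le> x" "x \<le> z B + 1" for x
      proof -
        have "x / s < 0" using that z_le s0 by (simp add: divide_neg_pos)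
        moreover have "- m / s < x / s" using that z_ge s0 by (intro divide_strict_right_mono) auto
        ultimately show ?thesis using s0 by (simp add: \<delta>_def)
      qed
      define g where "g = (\<lambda>x. (W B (x / s))\<^sup>2 - 1 + x)"
      have zB: "(1 - 2 * real (card B))\<^sup>2 - 1 + z B = 0" by (simp add: z_def power2_eq_square algebra_simps)
      have near: "\<bar>(W B (x / s))\<^sup>2 - (1 - 2 * real (card B))\<^sup>2\<bar> < 1" if "z B - 1 \<le> x" "x \<le> z B + 1" for x
        using \<delta>' range[OF that] by blast
      have "g (z B - 1) \<le> 0" using near[of "z B - 1"] zB by (simp add: g_def)
      moreover have "0 \<le> g (z B + 1)" using near[of "z B + 1"] zB by (simp add: g_def)
      moreover have "continuous_on {z B - 1..z B + 1} g"
        unfolding g_def using range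
        by (intro continuous_intros continuous_on_compose2[OF cont]) (use s0 range in \<open>auto simp: less_imp_le\<close>)
      ultimately obtain x where x: "z B - 1 \<le> x" "x \<le> z B + 1" "g x = 0"
        using IVT'[of g "z B - 1" 0 "z B + 1"] by auto
      then show ?thesis
        using range[of x] s0 by (intro exI[of _ "x / s"]) (auto simp: g_def \<delta>_def abs_le_iff)
    qed
    define D where "D = {B :: 'n set. 2 \<le> card B}"
    obtain y where y: "\<And>B. B \<in> D \<Longrightarrow> - \<delta> < y B \<and> y B < 0 \<and> \<bar>s * y B - z B\<bar> \<le> 1 \<and> (W B (y B))\<^sup>2 - 1 + s * y B = 0"
      using ex unfolding D_def mem_Collect_eq by metis
    have "inj_on y D"
    proof (rule inj_onI)
      fix A B assume AB: "A \<in> D" "B \<in> D" "y A = y B"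
      have "\<bar>s * y A - z A\<bar> \<le> 1" "\<bar>s * y A - z B\<bar> \<le> 1"
        using y[OF AB(1)] y[OF AB(2)] AB(3) by auto
      then have "\<bar>z A - z B\<bar> \<le> 2" by linarith
      have gap: "\<bar>z A - z B\<bar> > 2" if "card A < card B" "A \<in> D" for A B :: "'n set"
      proof -
        have "real (card A) \<le> real (card B) - 1" "2 \<le> real (card A)" using that by (auto simp: D_def)
        then have "real (card A) * (real (card A) - 1) + 2 * real (card A) \<le> real (card B) * (real (card B) - 1)"
          using mult_mono[of "real (card A) + 1" "real (card B)" "real (card A)" "real (card B) - 1"]
          by (simp add: algebra_simps)
        then show ?thesis using \<open>2 \<le> real (card A)\<close> by (simp add: z_def algebra_simps)
      qed
      have card_eq: "card A = card B"
        using gap[of A B] gap[of B A] AB \<open>\<bar>z A - z B\<bar> \<le> 2\<close>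
        by (metis abs_minus_commute linorder_neqE_nat not_le)
      have "(W A (y A))\<^sup>2 = (W B (y A))\<^sup>2"
        using y[OF AB(1)] y[OF AB(2)] AB(3) by simp
      moreover have "A \<noteq> {}" "B \<noteq> {}" using AB(1,2) by (auto simp: D_def)
      then have "W A (y A) < 0" "W B (y A) < 0"
        using \<delta>'[of "y A"] y[OF AB(1)] by (auto simp: \<delta>_def)
      ultimately have "W A (y A) = W B (y A)" by (auto simp: power2_eq_iff)
      then show "A = B"
        using \<delta>'[of "y A"] y[OF AB(1)] card_eq by (metis \<delta>_def minus_minus)
    qed
    then have "card (y ` D) = 2 ^ CARD('n) - CARD('n) - 1"
      by (simp add: card_image D_def card_sets_card_ge_2)
    moreover have "poly p (of_real x) = 0" if "x \<in> y ` D" for x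
    proof -
      from that obtain B where B: "B \<in> D" "x = y B" by blast
      then have "(\<Prod>B\<in>UNIV. (W B x)\<^sup>2 - 1 + s * x) = 0"
        using y[OF B(1)] by (intro prod_zero) auto
      moreover have "x \<le> 0" using y[OF B(1)] B(2) by simp
      ultimately show ?thesis by (simp only: poly_p of_real_0)
    qed
    ultimately show "poly p (-1) \<noteq> 0 \<and>
       (\<exists>Y. Y \<subseteq> {..<0} \<and> finite Y \<and> card Y = 2 ^ CARD('n) - CARD('n) - 1 \<and> (\<forall>y\<in>Y. poly p (of_real y) = 0))"
      using \<open>poly p (of_real (-1)) \<noteq> 0\<close> y by (intro conjI exI[of _ "y ` D"]) auto
  qed (use k b in auto)
qed

section \<open>Local rings\<close>

interpretation poly_fun: function_algebra "poly_fun :: (complex^'n^'n \<Rightarrow> complex) set"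
  by unfold_locales (auto intro: poly_fun.intros)

lemma poly_fun_tendsto: "f \<in> poly_fun \<Longrightarrow> (f \<longlongrightarrow> f P) (nhds P)"
proof (induction rule: poly_fun.induct)
  case (entry i j)
  show ?case by (intro tendsto_vec_nth) (rule filterlim_ident)
qed (auto intro: tendsto_add tendsto_mult)

lemma eventually_germ_iff:
  "(\<forall>\<^sub>F X in inf (nhds P) (principal L). Q X) \<longleftrightarrow> (\<forall>\<^sub>F X in nhds P. X \<in> L \<longrightarrow> Q X)"
  by (rule eventually_inf_principal)

lemma eventually_germ_at_point:
  "\<forall>\<^sub>F X in inf (nhds P) (principal L). Q X \<Longrightarrow> P \<in> L \<Longrightarrow> Q P"
  unfolding eventually_germ_iff by (drule eventually_nhds_x_imp_x) blast

lemma poly_fun_nonzero_near: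
  assumes "f \<in> poly_fun" "f P \<noteq> 0"
  shows "\<forall>\<^sub>F X in inf (nhds P) (principal L). f X \<noteq> 0"
  using tendsto_imp_eventually_ne[OF poly_fun_tendsto[OF assms(1)] assms(2)]
  by (rule filter_leD[OF inf_le1])

lemma local_ringE:
  assumes "f \<in> local_ring L P"
  obtains a b where "a \<in> poly_fun" "b \<in> poly_fun" "b P \<noteq> 0"
    "\<forall>\<^sub>F X in inf (nhds P) (principal L). b X \<noteq> 0 \<and> f X = a X / b X"
proof -
  obtain a b where ab: "a \<in> poly_fun" "b \<in> poly_fun" "b P \<noteq> 0"
    "\<forall>\<^sub>F X in inf (nhds P) (principal L). f X = a X / b X"
    using assms unfolding local_ring_def by blast
  show thesis
    by (rule that[OF ab(1,2,3) eventually_conj[OF poly_fun_nonzero_near[OF ab(2,3)] ab(4)]])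
qed

lemma local_ringI:
  "a \<in> poly_fun \<Longrightarrow> b \<in> poly_fun \<Longrightarrow> b P \<noteq> 0 \<Longrightarrow>
   \<forall>\<^sub>F X in inf (nhds P) (principal L). f X = a X / b X \<Longrightarrow> f \<in> local_ring L P"
  unfolding local_ring_def by blast

lemma poly_fun_in_local_ring: "f \<in> poly_fun \<Longrightarrow> f \<in> local_ring L P"
  by (rule local_ringI[OF _ poly_fun.const[of 1]]) auto

interpretation local_ring: function_algebra "local_ring L P" for L P
proof
  show "(\<lambda>x. c) \<in> local_ring L P" for c
    by (rule poly_fun_in_local_ring) (rule poly_fun.const)
next
  fix f g assume f: "f \<in> local_ring L P" and g: "g \<in> local_ring L P"
  obtain a b where ab: "a \<in> poly_fun" "b \<in> poly_fun" "b P \<noteq> 0"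
    "\<forall>\<^sub>F X in inf (nhds P) (principal L). b X \<noteq> 0 \<and> f X = a X / b X"
    using f by (rule local_ringE)
  obtain c d where cd: "c \<in> poly_fun" "d \<in> poly_fun" "d P \<noteq> 0"
    "\<forall>\<^sub>F X in inf (nhds P) (principal L). d X \<noteq> 0 \<and> g X = c X / d X"
    using g by (rule local_ringE)
  have bd: "(\<lambda>X. b X * d X) \<in> poly_fun" by (intro poly_fun.mult ab cd)
  have "(\<lambda>X. a X * d X + c X * b X) \<in> poly_fun" by (intro poly_fun.add poly_fun.mult ab cd)
  moreover have "\<forall>\<^sub>F X in inf (nhds P) (principal L). f X + g X = (a X * d X + c X * b X) / (b X * d X)"
    using ab(4) cd(4) by eventually_elim (simp add: add_frac_eq)
  ultimately show "(\<lambda>x. f x + g x) \<in> local_ring L P"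
    using bd ab(3) cd(3) by (intro local_ringI[where b = "\<lambda>X. b X * d X"]) auto
  have "(\<lambda>X. a X * c X) \<in> poly_fun" by (intro poly_fun.mult ab cd)
  moreover have "\<forall>\<^sub>F X in inf (nhds P) (principal L). f X * g X = (a X * c X) / (b X * d X)"
    using ab(4) cd(4) by eventually_elim auto
  ultimately show "(\<lambda>x. f x * g x) \<in> local_ring L P"
    using bd ab(3) cd(3) by (intro local_ringI[where b = "\<lambda>X. b X * d X"]) auto
qed

lemma local_ring_cong:
  assumes "f \<in> local_ring L P" "\<forall>\<^sub>F X in inf (nhds P) (principal L). f X = g X"
  shows "g \<in> local_ring L P"
proof -
  obtain a b where ab: "a \<in> poly_fun" "b \<in> poly_fun" "b P \<noteq> 0"
    "\<forall>\<^sub>F X in inf (nhds P) (principal L). b X \<noteq> 0 \<and> f X = a X / b X"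
    using assms(1) by (rule local_ringE)
  have "\<forall>\<^sub>F X in inf (nhds P) (principal L). g X = a X / b X"
    using ab(4) assms(2) by eventually_elim auto
  then show ?thesis using ab by (intro local_ringI)
qed

lemma local_ring_unit:
  assumes "f \<in> local_ring L P" "P \<in> L" "f P \<noteq> 0"
  shows "\<forall>\<^sub>F X in inf (nhds P) (principal L). f X \<noteq> 0"
    and "(\<lambda>X. inverse (f X)) \<in> local_ring L P"
proof -
  obtain a b where ab: "a \<in> poly_fun" "b \<in> poly_fun" "b P \<noteq> 0"
    "\<forall>\<^sub>F X in inf (nhds P) (principal L). b X \<noteq> 0 \<and> f X = a X / b X"
    using assms(1) by (rule local_ringE)
  have aP: "a P \<noteq> 0" using eventually_germ_at_point[OF ab(4) assms(2)] assms(3) by auto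
  have "\<forall>\<^sub>F X in inf (nhds P) (principal L). a X \<noteq> 0"
    by (rule poly_fun_nonzero_near[OF ab(1) aP])
  with ab(4) show "\<forall>\<^sub>F X in inf (nhds P) (principal L). f X \<noteq> 0"
    by eventually_elim auto
  have "\<forall>\<^sub>F X in inf (nhds P) (principal L). inverse (f X) = b X / a X"
    using ab(4) by eventually_elim (auto simp: inverse_eq_divide)
  then show "(\<lambda>X. inverse (f X)) \<in> local_ring L P"
    using ab aP by (intro local_ringI)
qed

lemma matrix_mult_diff_right: "A ** (B - C) = A ** B - A ** (C :: 'a::ring_1^'n^'m)"
  by (simp add: vec_eq_iff matrix_matrix_mult_def right_diff_distrib sum_subtractf)

lemma matrix_mult_diff_left: "(B - C) ** A = B ** A - C ** (A :: 'a::ring_1^'n^'m)"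
  by (simp add: vec_eq_iff matrix_matrix_mult_def left_diff_distrib sum_subtractf)

lemma matrix_inv_inverse:
  fixes A :: "'a::semiring_1^'n^'n"
  assumes "invertible A"
  shows "A ** matrix_inv A = mat 1" "matrix_inv A ** A = mat 1"
proof -
  have "A ** matrix_inv A = mat 1 \<and> matrix_inv A ** A = mat 1"
    using assms unfolding invertible_def matrix_inv_def by (rule someI_ex)
  then show "A ** matrix_inv A = mat 1" "matrix_inv A ** A = mat 1" by auto
qed

lemma matrix_inv_eqI:
  fixes A :: "'a::semiring_1^'n^'n"
  assumes "A ** B = mat 1" "B ** A = mat 1"
  shows "matrix_inv A = B" "invertible A"
proof -
  show "invertible A" using assms unfolding invertible_def by blast
  then show "matrix_inv A = B"
    by (metis assms(2) matrix_inv_inverse(1) matrix_mul_assoc matrix_mul_lid matrix_mul_rid)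
qed

text \<open>Cramer's rule for the columns of the inverse.\<close>

lemma matrix_inv_entry:
  fixes A :: "'a::field^'n^'n"
  assumes "det A \<noteq> 0"
  shows "matrix_inv A $ i $ j =
    det (\<chi> r c. if c = i then (if r = j then 1 else 0) else A $ r $ c) / det A"
proof -
  have inv: "invertible A" using assms by (simp add: invertible_det_nz)
  have "A *v column j (matrix_inv A) = column j (A ** matrix_inv A)"
    by (simp add: vec_eq_iff column_def matrix_vector_mult_def matrix_matrix_mult_def)
  also have "\<dots> = axis j 1"
    unfolding matrix_inv_inverse(1)[OF inv] by (simp add: vec_eq_iff column_def mat_def axis_def)
  finally have "column j (matrix_inv A) =
      (\<chi> k. det (\<chi> r c. if c = k then axis j 1 $ r else A $ r $ c) / det A)"
    using cramer[OF assms] by blast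
  then have "column j (matrix_inv A) $ i = det (\<chi> r c. if c = i then axis j 1 $ r else A $ r $ c) / det A"
    by simp
  then show ?thesis by (simp add: column_def axis_def cong: if_cong)
qed

text \<open>Cramer's rule within the local ring, where a function that does not vanish at \<open>P\<close> is a unit.\<close>

lemma local_ring_matrix_inv:
  fixes M :: "complex^'n^'n \<Rightarrow> complex^'m^'m"
  assumes M: "\<And>i j. (\<lambda>X. M X $ i $ j) \<in> local_ring L P" and P: "P \<in> L" "det (M P) \<noteq> 0"
  shows "\<forall>\<^sub>F X in inf (nhds P) (principal L). invertible (M X)"
    and "(\<lambda>X. matrix_inv (M X) $ i $ j) \<in> local_ring L P"
proof -
  have det: "(\<lambda>X. det (M X)) \<in> local_ring L P" by (intro local_ring.det M)
  note unit = local_ring_unit[OF det P]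
  show "\<forall>\<^sub>F X in inf (nhds P) (principal L). invertible (M X)"
    using unit(1) by eventually_elim (simp add: invertible_det_nz)
  have "(\<lambda>X. (\<chi> r c. if c = i then (if r = j then 1 else 0) else M X $ r $ c) $ r $ c) \<in> local_ring L P" for r c
    by (cases "c = i"; cases "r = j") (simp_all add: M local_ring.const)
  then have "(\<lambda>X. det (\<chi> r c. if c = i then (if r = j then 1 else 0) else M X $ r $ c)) \<in> local_ring L P"
    by (rule local_ring.det)
  from local_ring.mult[OF this unit(2)] show "(\<lambda>X. matrix_inv (M X) $ i $ j) \<in> local_ring L P"
    by (rule local_ring_cong) (use unit(1) in eventually_elim, simp add: matrix_inv_entry divide_inverse)
qed

text \<open>This makes the maximal ideal at \<open>P\<close> generated by the coordinates \<open>X $ i $ j - P $ i $ j\<close>.\<close>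

lemma poly_fun_taylor:
  fixes P :: "complex^'n^'n"
  assumes "f \<in> poly_fun"
  shows "\<exists>q. (\<forall>i j. q i j \<in> poly_fun) \<and>
    (\<forall>X. f X - f P = (\<Sum>i\<in>UNIV. \<Sum>j\<in>UNIV. (X $ i $ j - P $ i $ j) * q i j X))"
  using assms
proof induction
  case (const c)
  show ?case by (intro exI[of _ "\<lambda>i j X. 0"]) (auto intro: poly_fun.const)
next
  case (entry a b)
  have "(\<lambda>X. if i = a \<and> j = b then 1 else 0) \<in> (poly_fun :: (complex^'n^'n \<Rightarrow> complex) set)" for i j
    by (rule poly_fun.const)
  moreover have "(\<Sum>i\<in>UNIV. \<Sum>j\<in>UNIV. (X $ i $ j - P $ i $ j) * (if i = a \<and> j = b then 1 else 0)) =
      X $ a $ b - P $ a $ b" for X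
  proof -
    have "(\<Sum>j\<in>UNIV. (X $ i $ j - P $ i $ j) * (if i = a \<and> j = b then 1 else 0)) =
        (if i = a then X $ a $ b - P $ a $ b else 0)" for i
      by (cases "i = a") (simp_all add: if_distrib[of "(*) _"] cong: if_cong)
    then show ?thesis by simp
  qed
  ultimately show ?case by (intro exI[of _ "\<lambda>i j X. if i = a \<and> j = b then 1 else 0"]) auto
next
  case (add f g)
  then obtain q q' where q: "\<forall>i j. q i j \<in> poly_fun" "\<forall>i j. q' i j \<in> poly_fun"
    "\<And>X. f X - f P = (\<Sum>i\<in>UNIV. \<Sum>j\<in>UNIV. (X $ i $ j - P $ i $ j) * q i j X)"
    "\<And>X. g X - g P = (\<Sum>i\<in>UNIV. \<Sum>j\<in>UNIV. (X $ i $ j - P $ i $ j) * q' i j X)" by blast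
  have "f X + g X - (f P + g P) =
      (\<Sum>i\<in>UNIV. \<Sum>j\<in>UNIV. (X $ i $ j - P $ i $ j) * (q i j X + q' i j X))" for X
  proof -
    have "f X + g X - (f P + g P) = (f X - f P) + (g X - g P)" by simp
    also have "\<dots> = (\<Sum>i\<in>UNIV. \<Sum>j\<in>UNIV. (X $ i $ j - P $ i $ j) * (q i j X + q' i j X))"
      unfolding q(3)[of X] q(4)[of X] by (simp add: sum.distrib[symmetric] distrib_left)
    finally show ?thesis .
  qed
  then show ?case
    using q by (intro exI[of _ "\<lambda>i j X. q i j X + q' i j X"]) (auto intro: poly_fun.add)
next
  case (mult f g)
  then obtain q q' where q: "\<forall>i j. q i j \<in> poly_fun" "\<forall>i j. q' i j \<in> poly_fun"
    "\<And>X. f X - f P = (\<Sum>i\<in>UNIV. \<Sum>j\<in>UNIV. (X $ i $ j - P $ i $ j) * q i j X)"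
    "\<And>X. g X - g P = (\<Sum>i\<in>UNIV. \<Sum>j\<in>UNIV. (X $ i $ j - P $ i $ j) * q' i j X)" by blast
  have "f X * g X - f P * g P =
      (\<Sum>i\<in>UNIV. \<Sum>j\<in>UNIV. (X $ i $ j - P $ i $ j) * (q i j X * g X + f P * q' i j X))" for X
  proof -
    have "f X * g X - f P * g P = (f X - f P) * g X + f P * (g X - g P)" by (simp add: algebra_simps)
    also have "\<dots> = (\<Sum>i\<in>UNIV. \<Sum>j\<in>UNIV. (X $ i $ j - P $ i $ j) * (q i j X * g X + f P * q' i j X))"
      unfolding q(3)[of X] q(4)[of X]
      by (simp add: sum_distrib_left sum_distrib_right sum.distrib[symmetric] algebra_simps)
    finally show ?thesis .
  qed
  moreover have "(\<lambda>X. q i j X * g X + f P * q' i j X) \<in> poly_fun" for i j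
    using q mult.hyps by (intro poly_fun.add poly_fun.mult poly_fun.const) auto
  ultimately show ?case
    by (intro exI[of _ "\<lambda>i j X. q i j X * g X + f P * q' i j X"]) auto
qed

section \<open>Nondegenerate critical points\<close>

lemma trace_mult_eq_sum: "trace (A ** B) = (\<Sum>i\<in>UNIV. \<Sum>j\<in>UNIV. A $ i $ j * B $ j $ i)"
  by (simp add: trace_def matrix_matrix_mult_def)

lemma score_ideal_vanishes:
  assumes "f \<in> score_ideal L S P" "P \<in> critical_points L S"
  shows "f P = 0"
proof -
  obtain B h where B: "B \<subseteq> L"
    "\<forall>\<^sub>F X in inf (nhds P) (principal L). f X = (\<Sum>E\<in>B. h E X * score S E X)"
    using assms(1) unfolding score_ideal_def by blast
  have "f P = (\<Sum>E\<in>B. h E P * score S E P)"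
    using assms(2) by (intro eventually_germ_at_point[OF B(2)]) (auto simp: critical_points_def)
  also have "\<dots> = 0"
    using assms(2) B(1) by (intro sum.neutral) (auto simp: critical_points_def)
  finally show ?thesis .
qed

text \<open>By the resolvent identity \<open>X\<inverse> - P\<inverse> = - X\<inverse> (X - P) P\<inverse>\<close> this is an exact first-order expansion of
the score at \<open>P\<close>, with coefficients that are regular at \<open>P\<close>; no remainder term arises.\<close>

lemma score_expansion:
  fixes E :: "'m::finite \<Rightarrow> complex^'n^'n"
  assumes inv: "invertible X" "invertible P" and crit: "score S G P = 0"
    and c: "\<And>i j. X $ i $ j - P $ i $ j = (\<Sum>m\<in>UNIV. c m * E m $ i $ j)"
  shows "score S G X = (\<Sum>m\<in>UNIV. - trace (matrix_inv X ** E m ** matrix_inv P ** G) * c m)"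
proof -
  let ?Y = "matrix_inv X" and ?Q = "matrix_inv P"
  have tr: "trace (?Y ** D ** ?Q ** G) = (\<Sum>i\<in>UNIV. \<Sum>j\<in>UNIV. D $ i $ j * (?Q ** G ** ?Y) $ j $ i)" for D
  proof -
    have "trace (?Y ** D ** ?Q ** G) = trace (?Y ** (D ** ?Q ** G))" by (simp add: matrix_mul_assoc)
    also have "\<dots> = trace (D ** ?Q ** G ** ?Y)" by (rule trace_mul_sym)
    also have "\<dots> = trace (D ** (?Q ** G ** ?Y))" by (simp add: matrix_mul_assoc)
    finally show ?thesis by (simp only: trace_mult_eq_sum)
  qed
  have "?Y ** (X - P) ** ?Q = ?Q - ?Y"
  proof -
    have "?Y ** (X - P) ** ?Q = ?Y ** X ** ?Q - ?Y ** (P ** ?Q)"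
      by (simp add: matrix_mul_assoc matrix_mult_diff_right matrix_mult_diff_left)
    then show ?thesis by (simp add: matrix_inv_inverse inv)
  qed
  then have "trace (?Y ** (X - P) ** ?Q ** G) = trace (?Q ** G) - trace (?Y ** G)"
    by (simp add: matrix_mult_diff_left trace_sub)
  then have "score S G X = - trace (?Y ** (X - P) ** ?Q ** G)"
    using crit by (simp add: score_def)
  also have "trace (?Y ** (X - P) ** ?Q ** G) =
      (\<Sum>i\<in>UNIV. \<Sum>j\<in>UNIV. \<Sum>m\<in>UNIV. c m * E m $ i $ j * (?Q ** G ** ?Y) $ j $ i)"
    unfolding tr by (simp add: c sum_distrib_right)
  also have "\<dots> = (\<Sum>m\<in>UNIV. \<Sum>i\<in>UNIV. \<Sum>j\<in>UNIV. c m * E m $ i $ j * (?Q ** G ** ?Y) $ j $ i)"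
    by (subst sum.swap[of _ _ "UNIV :: 'n set"], subst sum.swap[of _ "UNIV :: 'm set"], rule refl)
  also have "\<dots> = (\<Sum>m\<in>UNIV. trace (?Y ** E m ** ?Q ** G) * c m)"
    unfolding tr by (simp add: sum_distrib_left sum_distrib_right mult_ac)
  finally show ?thesis by (simp add: sum_negf)
qed

text \<open>The ideal \<open>W\<close> is the kernel of the evaluation at \<open>P\<close>, so \<open>V / W\<close> is one-dimensional.\<close>

lemma quotient_dim_eq_1:
  assumes one: "(\<lambda>x. 1) \<in> V"
    and V: "\<And>f g a b. f \<in> V \<Longrightarrow> g \<in> V \<Longrightarrow> (\<lambda>x. a * f x + b * g x) \<in> V"
    and W: "\<And>f. f \<in> V \<Longrightarrow> f \<in> W \<longleftrightarrow> f P = 0"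
  shows "quotient_dim V W = 1"
proof (rule antisym)
  show "quotient_dim V W \<le> 1"
    unfolding quotient_dim_def
  proof (rule SUP_least, clarify)
    fix B assume B: "finite B" "B \<subseteq> V"
      and ind: "\<forall>c. (\<lambda>x. \<Sum>b\<in>B. c b * b x) \<in> W \<longrightarrow> (\<forall>b\<in>B. c b = 0)"
    have "b1 = b2" if b: "b1 \<in> B" "b2 \<in> B" for b1 b2
    proof (rule ccontr)
      assume ne: "b1 \<noteq> b2"
      have rel: "c1 = 0 \<and> c2 = 0" if "c1 * b1 P + c2 * b2 P = 0" for c1 c2
      proof -
        define c where "c = (\<lambda>b. if b = b1 then c1 else if b = b2 then c2 else 0)"
        have "(\<Sum>b\<in>B. c b * b x) = c1 * b1 x + c2 * b2 x" for x
        proof -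
          have "(\<Sum>b\<in>B. c b * b x) = (\<Sum>b\<in>{b1, b2}. c b * b x)"
            using b B(1) by (intro sum.mono_neutral_right) (auto simp: c_def)
          then show ?thesis using ne by (simp add: c_def)
        qed
        moreover have "(\<lambda>x. c1 * b1 x + c2 * b2 x) \<in> V" using b B(2) by (intro V) auto
        ultimately have "(\<lambda>x. \<Sum>b\<in>B. c b * b x) \<in> W" using W that by simp
        then have "c b1 = 0" "c b2 = 0" using ind b by blast+
        then show ?thesis using ne by (simp add: c_def)
      qed
      have "b2 P = 0" "b1 P = 0" using rel[of "b2 P" "- b1 P"] by auto
      then show False using rel[of 1 1] by simp
    qed
    then have "card B \<le> 1" using B(1) by (simp add: card_le_Suc0_iff_eq)
    then show "enat (card B) \<le> 1" by (simp add: one_enat_def)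
  qed
  have "(\<lambda>x. 1) \<notin> W" using W[OF one] by simp
  have "c = 0" if "(\<lambda>x. c * 1) \<in> W" for c
  proof -
    have "(\<lambda>x. c * 1 + 0 * 1) \<in> V" by (intro V one)
    then show ?thesis using W that by simp
  qed
  then have "{\<lambda>x. 1} \<in> {B. finite B \<and> B \<subseteq> V \<and> (\<forall>c. (\<lambda>x. \<Sum>b\<in>B. c b * b x) \<in> W \<longrightarrow> (\<forall>b\<in>B. c b = 0))}"
    using one by simp
  from SUP_upper[OF this, of "\<lambda>B. enat (card B)"] show "1 \<le> quotient_dim V W"
    by (simp add: quotient_dim_def one_enat_def)
qed

text \<open>The expansion of the scores says \<open>score = A X \<cdot> c\<close>, where \<open>c\<close> are the coordinates of \<open>X - P\<close>.  At \<open>P\<close>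
the matrix \<open>A P\<close> is the Hessian, which is invertible by assumption.  Hence \<open>A X\<close> is invertible near
\<open>P\<close> with an inverse over the local ring, and all coordinates, so the whole maximal ideal, lie in
the ideal generated by the scores.\<close>

lemma nondegenerate_multiplicity_1:
  fixes E :: "'m::finite \<Rightarrow> complex^'n^'n"
  assumes P: "P \<in> critical_points L S"
    and E: "inj E" "\<And>m. E m \<in> L"
    and span: "\<And>X. X \<in> L \<Longrightarrow> \<exists>c. \<forall>i j. X $ i $ j - P $ i $ j = (\<Sum>m\<in>UNIV. c m * E m $ i $ j)"
    and nondeg: "\<And>c. (\<And>l. (\<Sum>m\<in>UNIV. trace (matrix_inv P ** E m ** matrix_inv P ** E l) * c m) = 0) \<Longrightarrow>
      (\<And>m. c m = 0)"
  shows "multiplicity_at L S P = 1"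
proof -
  have PL: "P \<in> L" and invP: "invertible P" and crit: "\<And>m. score S (E m) P = 0"
    using P E(2) by (auto simp: critical_points_def)
  define A where "A = (\<lambda>X. \<chi> l m. - trace (matrix_inv X ** E m ** matrix_inv P ** E l))"
  have "x = 0" if "A P *v x = 0" for x
  proof -
    have "(\<Sum>m\<in>UNIV. trace (matrix_inv P ** E m ** matrix_inv P ** E l) * x $ m) = - (A P *v x) $ l" for l
      by (simp add: A_def matrix_vector_mult_def sum_negf)
    then have "x $ m = 0" for m using nondeg[of "\<lambda>m. x $ m"] that by simp
    then show ?thesis by (simp add: vec_eq_iff)
  qed
  then have "invertible (A P)"
    using matrix_left_invertible_ker invertible_left_inverse by blast
  then have det_AP: "det (A P) \<noteq> 0" by (simp add: invertible_det_nz)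
  have invs: "(\<lambda>X. matrix_inv X $ i $ j) \<in> local_ring L P"
    and ev_inv: "\<forall>\<^sub>F X in inf (nhds P) (principal L). invertible X" for i j
    using local_ring_matrix_inv(1)[of "\<lambda>X. X" L P] local_ring_matrix_inv(2)[of "\<lambda>X. X" L P i j] PL invP
    by (auto simp: invertible_det_nz intro: poly_fun_in_local_ring poly_fun.entry)
  have "(\<lambda>X. A X $ l $ m) \<in> local_ring L P" for l m
  proof -
    have "A X $ l $ m = - trace (matrix_inv X ** (E m ** matrix_inv P ** E l))" for X
      by (simp add: A_def matrix_mul_assoc)
    then show ?thesis
      unfolding trace_mult_eq_sum
      by (auto intro!: local_ring.uminus local_ring.sum local_ring.mult local_ring.const invs)
  qed
  note Ainv = local_ring_matrix_inv[OF this PL det_AP]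
  have ideal: "f \<in> score_ideal L S P" if f: "f \<in> local_ring L P" "f P = 0" for f
  proof -
    obtain a b where ab: "a \<in> poly_fun" "b \<in> poly_fun" "b P \<noteq> 0"
      "\<forall>\<^sub>F X in inf (nhds P) (principal L). b X \<noteq> 0 \<and> f X = a X / b X"
      using f(1) by (rule local_ringE)
    have aP: "a P = 0" using eventually_germ_at_point[OF ab(4) PL] f(2) by auto
    obtain q where q: "\<And>i j. q i j \<in> poly_fun"
      "\<And>X. a X - a P = (\<Sum>i\<in>UNIV. \<Sum>j\<in>UNIV. (X $ i $ j - P $ i $ j) * q i j X)"
      using poly_fun_taylor[OF ab(1)] by blast
    define g where "g = (\<lambda>m X. (\<Sum>i\<in>UNIV. \<Sum>j\<in>UNIV. E m $ i $ j * q i j X) * inverse (b X))"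
    define h where "h = (\<lambda>l X. \<Sum>m\<in>UNIV. g m X * matrix_inv (A X) $ m $ l)"
    have b_unit: "(\<lambda>X. inverse (b X)) \<in> local_ring L P"
      by (rule local_ring_unit(2)[OF poly_fun_in_local_ring[OF ab(2)] PL ab(3)])
    have h: "h l \<in> local_ring L P" for l
      unfolding h_def g_def
      by (intro local_ring.sum local_ring.mult Ainv(2) local_ring.const b_unit
          poly_fun_in_local_ring[OF q(1)])
    have "\<forall>\<^sub>F X in inf (nhds P) (principal L). X \<in> L"
      by (simp add: eventually_inf_principal)
    then have "\<forall>\<^sub>F X in inf (nhds P) (principal L). f X = (\<Sum>l\<in>UNIV. h l X * score S (E l) X)"
      using ab(4) ev_inv Ainv(1)
    proof eventually_elim
      case (elim X)
      obtain c where c: "\<And>i j. X $ i $ j - P $ i $ j = (\<Sum>m\<in>UNIV. c m * E m $ i $ j)"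
        using span[OF elim(1)] by blast
      have "(A X *v (\<chi> m. c m)) $ l = score S (E l) X" for l
        using score_expansion[OF elim(3) invP crit c]
        by (simp add: A_def matrix_vector_mult_def)
      then have "A X *v (\<chi> m. c m) = (\<chi> l. score S (E l) X)" by (simp add: vec_eq_iff)
      then have "(\<chi> m. c m) = matrix_inv (A X) *v (\<chi> l. score S (E l) X)"
        by (metis matrix_inv_inverse(2)[OF elim(4)] matrix_vector_mul_assoc matrix_vector_mul_lid)
      then have cm: "c m = (\<Sum>l\<in>UNIV. matrix_inv (A X) $ m $ l * score S (E l) X)" for m
        by (simp add: vec_eq_iff matrix_vector_mult_def)
      have "a X = (\<Sum>i\<in>UNIV. \<Sum>j\<in>UNIV. \<Sum>m\<in>UNIV. c m * E m $ i $ j * q i j X)"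
        using q(2)[of X] by (simp add: aP c sum_distrib_right)
      also have "\<dots> = (\<Sum>m\<in>UNIV. \<Sum>i\<in>UNIV. \<Sum>j\<in>UNIV. c m * E m $ i $ j * q i j X)"
        by (subst sum.swap[of _ _ "UNIV :: 'n set"], subst sum.swap[of _ "UNIV :: 'm set"], rule refl)
      finally have "f X = (\<Sum>m\<in>UNIV. g m X * c m)"
        using elim(2) by (simp add: g_def divide_inverse sum_distrib_left sum_distrib_right mult_ac)
      also have "\<dots> = (\<Sum>m\<in>UNIV. \<Sum>l\<in>UNIV. g m X * matrix_inv (A X) $ m $ l * score S (E l) X)"
        by (simp add: cm sum_distrib_left mult_ac)
      also have "\<dots> = (\<Sum>l\<in>UNIV. h l X * score S (E l) X)"
        by (subst sum.swap) (simp add: h_def sum_distrib_right)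
      finally show ?case .
    qed
    moreover have "(\<Sum>l\<in>UNIV. h l X * score S (E l) X) =
        (\<Sum>G\<in>range E. h (inv_into UNIV E G) X * score S G X)" for X
      by (subst sum.reindex[OF E(1)]) (simp add: inv_f_f[OF E(1)])
    ultimately show ?thesis
      unfolding score_ideal_def mem_Collect_eq using E(2) h
      by (intro exI[of _ "range E"] exI[of _ "\<lambda>G. h (inv_into UNIV E G)"]) auto
  qed
  show ?thesis
    unfolding multiplicity_at_def
  proof (rule quotient_dim_eq_1[where P = P])
    show "(\<lambda>x. 1) \<in> local_ring L P" by (rule local_ring.const)
    show "(\<lambda>x. a * f x + b * g x) \<in> local_ring L P"
      if "f \<in> local_ring L P" "g \<in> local_ring L P" for f g a b
      by (intro local_ring.add local_ring.mult local_ring.const that)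
    show "f \<in> score_ideal L S P \<longleftrightarrow> f P = 0" if "f \<in> local_ring L P" for f
      using ideal that score_ideal_vanishes[OF _ P] by blast
  qed
qed

section \<open>Matrices in the model\<close>

definition star_matrix :: "('n \<Rightarrow> complex) \<Rightarrow> complex \<Rightarrow> complex^'n^'n" where
  "star_matrix d t = (\<chi> i j. (if i = j then d i else 0) + t)"

definition entry_sum :: "complex^'n^'n \<Rightarrow> complex" where
  "entry_sum A = (\<Sum>i\<in>UNIV. \<Sum>j\<in>UNIV. A $ i $ j)"

abbreviation complex_star_space :: "(complex^'n^'n) set" where
  "complex_star_space \<equiv> complexification star_space"

lemma mem_complex_star_space_iff:
  "X \<in> complex_star_space \<longleftrightarrow> (\<forall>i j k l. i \<noteq> j \<and> k \<noteq> l \<longrightarrow> X $ i $ j = X $ k $ l)"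
  unfolding complexification_def star_space_altdef mem_Collect_eq complex_eq_iff vec_lambda_beta
    imp_conjR all_conj_distrib ..

lemma star_matrix_mem: "star_matrix d t \<in> complex_star_space"
  by (simp add: mem_complex_star_space_iff star_matrix_def)

lemma star_matrix_cases:
  fixes X :: "complex^'n^'n"
  assumes "X \<in> complex_star_space"
  obtains d t where "X = star_matrix d t"
proof (cases "\<exists>a b :: 'n. a \<noteq> b")
  case True
  then obtain a b :: 'n where ab: "a \<noteq> b" by blast
  have "X = star_matrix (\<lambda>i. X $ i $ i - X $ a $ b) (X $ a $ b)"
  proof -
    have "X $ i $ j = star_matrix (\<lambda>i. X $ i $ i - X $ a $ b) (X $ a $ b) $ i $ j" for i j
    proof (cases "i = j")
      case False
      then have "X $ i $ j = X $ a $ b"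
        using assms ab unfolding mem_complex_star_space_iff by blast
      then show ?thesis using False by (simp add: star_matrix_def)
    qed (simp add: star_matrix_def)
    then show ?thesis unfolding vec_eq_iff by blast
  qed
  then show ?thesis by (rule that)
next
  case False
  have "X $ i $ j = star_matrix (\<lambda>i. X $ i $ i) 0 $ i $ j" for i j
  proof -
    have "i = j" using False by blast
    then show ?thesis by (simp add: star_matrix_def)
  qed
  then have "X = star_matrix (\<lambda>i. X $ i $ i) 0" unfolding vec_eq_iff by blast
  then show ?thesis by (rule that)
qed

lemma star_matrix_eq_iff:
  fixes d :: "'n::finite \<Rightarrow> complex"
  assumes "CARD('n) \<ge> 2"
  shows "star_matrix d t = star_matrix d' t' \<longleftrightarrow> d = d' \<and> t = t'"
proof
  assume eq: "star_matrix d t = star_matrix d' t'"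
  obtain a b :: 'n where ab: "a \<noteq> b"
    using assms card_2_iff' ex_card[OF assms] by (metis UNIV_I)
  have entry: "star_matrix d t $ i $ j = star_matrix d' t' $ i $ j" for i j using eq by simp
  have t: "t = t'" using entry[of a b] ab by (simp add: star_matrix_def)
  moreover have "d i = d' i" for i using entry[of i i] t by (simp add: star_matrix_def)
  ultimately show "d = d' \<and> t = t'" by auto
qed auto

text \<open>The elementary diagonal matrices, and the all-ones matrix for \<open>None\<close>.\<close>

definition star_basis :: "'n option \<Rightarrow> complex^'n^'n" where
  "star_basis m = (case m of None \<Rightarrow> star_matrix (\<lambda>_. 0) 1
     | Some i \<Rightarrow> star_matrix (\<lambda>j. if j = i then 1 else 0) 0)"

lemma star_basis_mem: "star_basis m \<in> complex_star_space"
  by (cases m) (simp_all add: star_basis_def star_matrix_mem)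

lemma star_basis_inj:
  assumes "CARD('n::finite) \<ge> 2"
  shows "inj (star_basis :: 'n option \<Rightarrow> _)"
proof (rule injI)
  fix m l :: "'n option"
  assume "star_basis m = star_basis l"
  then show "m = l"
    by (cases m; cases l)
       (auto simp: star_basis_def star_matrix_eq_iff[OF assms] fun_eq_iff split: if_splits)
qed

lemma sum_UNIV_option:
  fixes f :: "'n::finite option \<Rightarrow> 'a::comm_monoid_add"
  shows "(\<Sum>m\<in>UNIV. f m) = f None + (\<Sum>i\<in>UNIV. f (Some i))"
  unfolding UNIV_option_conv by (subst sum.insert) (auto simp: sum.reindex)

lemma star_basis_span:
  "(star_matrix d t - star_matrix d' t') $ i $ j =
    (\<Sum>m\<in>UNIV. (case m of None \<Rightarrow> t - t' | Some a \<Rightarrow> d a - d' a) * star_basis m $ i $ j)"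
proof -
  have "(\<Sum>a\<in>UNIV. (d a - d' a) * (if i = j then if i = a then 1 else 0 else 0)) =
      (if i = j then d i - d' i else 0)"
    by (simp add: if_distrib[of "(*) _"] cong: if_cong)
  then show ?thesis
    by (simp add: sum_UNIV_option star_basis_def star_matrix_def)
qed

lemma trace_mult_star_matrix:
  "trace (A ** star_matrix d t) = (\<Sum>i\<in>UNIV. d i * A $ i $ i) + t * entry_sum A"
proof -
  have "trace (A ** star_matrix d t) = (\<Sum>i\<in>UNIV. \<Sum>j\<in>UNIV. A $ i $ j * ((if j = i then d j else 0) + t))"
    by (simp add: trace_def matrix_matrix_mult_def star_matrix_def)
  also have "\<dots> = (\<Sum>i\<in>UNIV. d i * A $ i $ i + (\<Sum>j\<in>UNIV. A $ i $ j * t))"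
    by (intro sum.cong refl) (simp add: distrib_left sum.distrib if_distrib[of "(*) _"] mult.commute cong: if_cong)
  also have "\<dots> = (\<Sum>i\<in>UNIV. d i * A $ i $ i) + t * entry_sum A"
    by (simp add: sum.distrib entry_sum_def sum_distrib_left sum_distrib_right mult.commute)
  finally show ?thesis .
qed

lemma trace_mult_star_basis:
  "trace (A ** star_basis m) = (case m of None \<Rightarrow> entry_sum A | Some i \<Rightarrow> A $ i $ i)"
proof (cases m)
  case (Some a)
  have "(\<Sum>i\<in>UNIV. (if i = a then 1 else 0) * A $ i $ i) = A $ a $ a"
    by (simp add: if_distrib[of "\<lambda>x. x * _"] cong: if_cong)
  then show ?thesis using Some by (simp add: star_basis_def trace_mult_star_matrix)
qed (simp add: star_basis_def trace_mult_star_matrix)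

lemma matrix_mult_entry: "(A ** B) $ i $ j = (\<Sum>a\<in>UNIV. A $ i $ a * B $ a $ j)"
  by (simp add: matrix_matrix_mult_def)

lemma star_basis_sandwich:
  "(A ** star_basis m ** B) $ i $ j = (case m of
     None \<Rightarrow> (\<Sum>a\<in>UNIV. A $ i $ a) * (\<Sum>b\<in>UNIV. B $ b $ j) | Some a \<Rightarrow> A $ i $ a * B $ a $ j)"
proof (cases m)
  case None
  have "(A ** star_basis None) $ i $ b = (\<Sum>a\<in>UNIV. A $ i $ a)" for b
    by (simp add: star_basis_def star_matrix_def matrix_mult_entry)
  then have "(A ** star_basis None ** B) $ i $ j = (\<Sum>a\<in>UNIV. A $ i $ a) * (\<Sum>b\<in>UNIV. B $ b $ j)"
    by (simp only: matrix_mult_entry[of "A ** star_basis None"] sum_distrib_left)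
  then show ?thesis using None by simp
next
  case (Some a)
  have "(A ** star_basis (Some a)) $ i $ b = (if b = a then A $ i $ a else 0)" for b
    by (simp add: star_basis_def star_matrix_def matrix_mult_entry if_distrib[of "(*) _"] cong: if_cong)
  then have "(A ** star_basis (Some a) ** B) $ i $ j =
      (\<Sum>b\<in>UNIV. (if b = a then A $ i $ a else 0) * B $ b $ j)"
    by (simp only: matrix_mult_entry[of "A ** star_basis (Some a)"])
  also have "\<dots> = (\<Sum>b\<in>UNIV. if b = a then A $ i $ a * B $ a $ j else 0)"
    by (intro sum.cong) auto
  finally show ?thesis using Some by simp
qed

text \<open>The derivative in the direction \<open>diag e + c J\<close> compares weighted diagonal entries and entry sums.\<close>

lemma critical_points_star_iff:
  "X \<in> critical_points complex_star_space S \<longleftrightarrow> X \<in> complex_star_space \<and> invertible X \<and>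
    (\<forall>i. matrix_inv X $ i $ i = matrix_inv S $ i $ i) \<and> entry_sum (matrix_inv X) = entry_sum (matrix_inv S)"
  (is "_ \<longleftrightarrow> _ \<and> _ \<and> ?eqs")
proof -
  have "(\<forall>E\<in>complex_star_space. score S E X = 0) \<longleftrightarrow> ?eqs"
  proof
    assume *: "\<forall>E\<in>complex_star_space. score S E X = 0"
    have "trace (matrix_inv X ** star_basis m) = trace (matrix_inv S ** star_basis m)" for m
      using * star_basis_mem[of m] by (auto simp: score_def)
    note this[of "Some _"] this[of None]
    then show ?eqs by (simp add: trace_mult_star_basis)
  next
    assume ?eqs
    then show "\<forall>E\<in>complex_star_space. score S E X = 0"
      by (auto simp: score_def trace_mult_star_matrix elim!: star_matrix_cases)
  qed
  then show ?thesis by (auto simp: critical_points_def)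
qed

section \<open>Critical points and solutions of the reduced system\<close>

text \<open>The condition \<open>\<tau> \<noteq> 0\<close> excludes the diagonal matrices \<open>X\<close>, which are critical for no generic \<open>S\<close>.\<close>

definition reduced_solutions :: "('n::finite \<Rightarrow> complex) \<Rightarrow> complex \<Rightarrow> (('n \<Rightarrow> complex) \<times> complex) set" where
  "reduced_solutions k s = {(u, \<tau>). \<tau> \<noteq> 0 \<and> (\<forall>i. u i - \<tau> * (u i)\<^sup>2 = k i) \<and>
     (\<Sum>i\<in>UNIV. u i) - \<tau> * (\<Sum>i\<in>UNIV. u i)\<^sup>2 = s}"

definition solution_inverse :: "('n::finite \<Rightarrow> complex) \<times> complex \<Rightarrow> complex^'n^'n" where
  "solution_inverse = (\<lambda>(u, \<tau>). \<chi> i j. (if i = j then u i else 0) - \<tau> * u i * u j)"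

definition solution_matrix :: "('n::finite \<Rightarrow> complex) \<times> complex \<Rightarrow> complex^'n^'n" where
  "solution_matrix = (\<lambda>(u, \<tau>). star_matrix (\<lambda>i. 1 / u i) (\<tau> / (1 - \<tau> * (\<Sum>i\<in>UNIV. u i))))"

text \<open>The Sherman-Morrison formula for the rank-one perturbation \<open>t J\<close> of \<open>diag (1 / u)\<close>.\<close>

lemma solution_matrix_inverse:
  fixes u :: "'n::finite \<Rightarrow> complex"
  assumes u: "\<And>i. u i \<noteq> 0" and p: "1 - \<tau> * (\<Sum>i\<in>UNIV. u i) \<noteq> 0"
  shows "matrix_inv (solution_matrix (u, \<tau>)) = solution_inverse (u, \<tau>)"
    and "invertible (solution_matrix (u, \<tau>))"
proof -
  define q where "q = 1 - \<tau> * (\<Sum>i\<in>UNIV. u i)"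
  have q: "q \<noteq> 0" using p by (simp add: q_def)
  have "(solution_matrix (u, \<tau>) ** solution_inverse (u, \<tau>)) $ i $ j = (if i = j then 1 else 0)" for i j
  proof -
    define r where "r = \<tau> / q"
    define b where "b = 1 / u i * ((if i = j then u i else 0) - \<tau> * u i * u j)"
    have "(solution_matrix (u, \<tau>) ** solution_inverse (u, \<tau>)) $ i $ j =
        (\<Sum>a\<in>UNIV. ((if i = a then 1 / u i else 0) + r) * ((if a = j then u a else 0) - \<tau> * u a * u j))"
      by (simp add: matrix_mult_entry solution_matrix_def solution_inverse_def star_matrix_def q_def r_def)
    also have "\<dots> = (\<Sum>a\<in>UNIV. (if i = a then b else 0) +
        ((if a = j then r * u j else 0) - r * (\<tau> * u j) * u a))"
      by (intro sum.cong) (auto simp: b_def algebra_simps)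
    also have "\<dots> = b + (r * u j - r * (\<tau> * u j) * (\<Sum>a\<in>UNIV. u a))"
      by (simp add: sum.distrib sum_subtractf sum_distrib_left)
    also have "r * u j - r * (\<tau> * u j) * (\<Sum>a\<in>UNIV. u a) = r * q * u j"
      by (simp add: q_def algebra_simps)
    also have "r * q = \<tau>" using q by (simp add: r_def)
    also have "b + \<tau> * u j = (if i = j then 1 else 0)"
      using u[of i] u[of j] by (simp add: b_def right_diff_distrib)
    finally show ?thesis .
  qed
  then have *: "solution_matrix (u, \<tau>) ** solution_inverse (u, \<tau>) = mat 1"
    by (simp add: vec_eq_iff mat_def)
  then have "solution_inverse (u, \<tau>) ** solution_matrix (u, \<tau>) = mat 1"
    by (simp add: matrix_left_right_inverse)
  from matrix_inv_eqI[OF * this]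
  show "matrix_inv (solution_matrix (u, \<tau>)) = solution_inverse (u, \<tau>)"
    and "invertible (solution_matrix (u, \<tau>))" by auto
qed

lemma solution_inverse_entries:
  "solution_inverse (u, \<tau>) $ i $ i = u i - \<tau> * (u i)\<^sup>2"
  "(\<Sum>j\<in>UNIV. solution_inverse (u, \<tau>) $ i $ j) = u i * (1 - \<tau> * (\<Sum>i\<in>UNIV. u i))"
  "(\<Sum>j\<in>UNIV. solution_inverse (u, \<tau>) $ j $ i) = u i * (1 - \<tau> * (\<Sum>i\<in>UNIV. u i))"
  "entry_sum (solution_inverse (u, \<tau>)) = (\<Sum>i\<in>UNIV. u i) - \<tau> * (\<Sum>i\<in>UNIV. u i)\<^sup>2"
proof -
  show "solution_inverse (u, \<tau>) $ i $ i = u i - \<tau> * (u i)\<^sup>2"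
    by (simp add: solution_inverse_def power2_eq_square)
  have row: "(\<Sum>j\<in>UNIV. solution_inverse (u, \<tau>) $ i $ j) = u i * (1 - \<tau> * (\<Sum>i\<in>UNIV. u i))" for i
  proof -
    have "(\<Sum>j\<in>UNIV. solution_inverse (u, \<tau>) $ i $ j) = u i - (\<Sum>j\<in>UNIV. \<tau> * u i * u j)"
      by (simp add: solution_inverse_def sum_subtractf)
    also have "(\<Sum>j\<in>UNIV. \<tau> * u i * u j) = \<tau> * u i * (\<Sum>j\<in>UNIV. u j)"
      by (simp only: sum_distrib_left)
    finally show ?thesis by (simp add: algebra_simps)
  qed
  show "(\<Sum>j\<in>UNIV. solution_inverse (u, \<tau>) $ i $ j) = u i * (1 - \<tau> * (\<Sum>i\<in>UNIV. u i))"
    by (rule row)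
  have "solution_inverse (u, \<tau>) $ j $ i = solution_inverse (u, \<tau>) $ i $ j" for j
    by (auto simp: solution_inverse_def)
  then show "(\<Sum>j\<in>UNIV. solution_inverse (u, \<tau>) $ j $ i) = u i * (1 - \<tau> * (\<Sum>i\<in>UNIV. u i))"
    using row by simp
  show "entry_sum (solution_inverse (u, \<tau>)) = (\<Sum>i\<in>UNIV. u i) - \<tau> * (\<Sum>i\<in>UNIV. u i)\<^sup>2"
    unfolding entry_sum_def row sum_distrib_right[symmetric] by (simp add: power2_eq_square algebra_simps)
qed

lemma mat_1_entry: "mat 1 $ i $ j = (if i = j then 1 else 0)"
  by (simp add: mat_def)

text \<open>Let \<open>Q\<close> be the inverse and \<open>c\<close> its column sums.  The product with \<open>Q\<close> reads
\<open>d i * Q $ i $ j + t * c j = (if i = j then 1 else 0)\<close>.  If \<open>d a = 0\<close>, row \<open>a\<close> shows \<open>c j = 0\<close> for \<open>j \<noteq> a\<close>, and the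
other rows give \<open>Q $ i $ a = - Q $ i $ i\<close>, so that \<open>s = c a\<close> is the first alternative.  Otherwise each
row can be divided by \<open>d i\<close>, and summation over \<open>i\<close> determines \<open>c\<close>.\<close>

lemma star_matrix_inverse_cases:
  fixes d :: "'n::finite \<Rightarrow> complex"
  assumes inv: "invertible (star_matrix d t)"
    and k: "\<And>i. k i = matrix_inv (star_matrix d t) $ i $ i"
    and s: "s = entry_sum (matrix_inv (star_matrix d t))"
  shows "(\<exists>a. s = 2 * k a - (\<Sum>i\<in>UNIV. k i)) \<or>
    (\<exists>u \<tau>. star_matrix d t = solution_matrix (u, \<tau>) \<and> (\<forall>i. u i - \<tau> * (u i)\<^sup>2 = k i) \<and>
      (\<Sum>i\<in>UNIV. u i) - \<tau> * (\<Sum>i\<in>UNIV. u i)\<^sup>2 = s)"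
proof -
  define Q where "Q = matrix_inv (star_matrix d t)"
  define c where "c = (\<lambda>j. \<Sum>i\<in>UNIV. Q $ i $ j)"
  have "(star_matrix d t ** Q) $ i $ j = d i * Q $ i $ j + t * c j" for i j
  proof -
    have "(star_matrix d t ** Q) $ i $ j = (\<Sum>a\<in>UNIV. (if i = a then d i * Q $ a $ j else 0) + t * Q $ a $ j)"
      by (auto simp: matrix_matrix_mult_def star_matrix_def algebra_simps intro!: sum.cong)
    then show ?thesis by (simp add: sum.distrib c_def sum_distrib_left[symmetric])
  qed
  moreover have "star_matrix d t ** Q = mat 1" using inv by (simp add: Q_def matrix_inv_inverse)
  ultimately have row: "d i * Q $ i $ j + t * c j = (if i = j then 1 else 0)" for i j
    by (metis (no_types) mat_1_entry)
  have s_c: "s = (\<Sum>j\<in>UNIV. c j)"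
    unfolding s Q_def[symmetric] entry_sum_def c_def by (rule sum.swap)
  show ?thesis
  proof (cases "\<exists>a. d a = 0")
    case True
    then obtain a where a: "d a = 0" by blast
    have tc: "t * c j = (if a = j then 1 else 0)" for j using row[of a j] a by simp
    have t: "t \<noteq> 0" using tc[of a] by auto
    then have c: "c j = 0" if "j \<noteq> a" for j using tc[of j] that by auto
    have "s = c a" unfolding s_c by (rule sum.remove[of _ a, THEN trans]) (auto simp: c)
    also have "c a = Q $ a $ a + (\<Sum>i\<in>UNIV - {a}. Q $ i $ a)"
      unfolding c_def by (rule sum.remove) auto
    also have "(\<Sum>i\<in>UNIV - {a}. Q $ i $ a) = (\<Sum>i\<in>UNIV - {a}. - k i)"
    proof (rule sum.cong)
      fix i assume "i \<in> UNIV - {a}"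
      then have i: "i \<noteq> a" by simp
      have "d i * Q $ i $ i = 1" using row[of i i] c[OF i] by simp
      moreover have "d i * Q $ i $ a = - 1" using row[of i a] tc[of a] i by (simp add: eq_neg_iff_add_eq_0)
      ultimately have "d i * (Q $ i $ a + Q $ i $ i) = 0" "d i \<noteq> 0" by (auto simp: distrib_left)
      then show "Q $ i $ a = - k i" by (simp add: k Q_def eq_neg_iff_add_eq_0)
    qed simp
    also have "(\<Sum>i\<in>UNIV. k i) = k a + (\<Sum>i\<in>UNIV - {a}. k i)" by (rule sum.remove) auto
    then have "Q $ a $ a + (\<Sum>i\<in>UNIV - {a}. - k i) = 2 * k a - (\<Sum>i\<in>UNIV. k i)"
      by (simp add: sum_negf k Q_def)
    finally show ?thesis by blast
  next
    case False
    define u where "u = (\<lambda>i. 1 / d i)"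
    define p where "p = (\<Sum>i\<in>UNIV. u i)"
    have d: "d i \<noteq> 0" for i using False by blast
    then have u: "u i \<noteq> 0" for i by (simp add: u_def)
    have Q: "Q $ i $ j = u i * ((if i = j then 1 else 0) - t * c j)" for i j
      using row[of i j] d[of i] by (simp add: u_def field_simps)
    have "c j = u j - t * p * c j" for j
    proof -
      have "c j = (\<Sum>i\<in>UNIV. Q $ i $ j)" by (simp add: c_def)
      also have "\<dots> = (\<Sum>i\<in>UNIV. (if i = j then u j else 0) - t * c j * u i)"
        by (intro sum.cong) (auto simp: Q algebra_simps)
      also have "\<dots> = u j - t * c j * p"
        unfolding p_def sum_distrib_left by (simp add: sum_subtractf)
      finally show ?thesis by (simp only: mult_ac)
    qed
    then have "c j + t * p * c j = u j" for j unfolding eq_diff_eq .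
    then have cj: "c j * (1 + t * p) = u j" for j by (simp add: algebra_simps)
    then have tp: "1 + t * p \<noteq> 0" using u by (metis mult_zero_right)
    define \<tau> where "\<tau> = t / (1 + t * p)"
    have q: "1 - \<tau> * p = 1 / (1 + t * p)"
      using tp by (simp add: \<tau>_def field_simps)
    have t: "t = \<tau> / (1 - \<tau> * p)" unfolding q using tp by (simp add: \<tau>_def)
    have eq: "star_matrix d t = solution_matrix (u, \<tau>)"
      unfolding solution_matrix_def using t by (simp add: u_def p_def)
    have "matrix_inv (solution_matrix (u, \<tau>)) = solution_inverse (u, \<tau>)"
      using u q tp unfolding p_def by (intro solution_matrix_inverse) auto
    then have "(\<forall>i. u i - \<tau> * (u i)\<^sup>2 = k i) \<and> (\<Sum>i\<in>UNIV. u i) - \<tau> * (\<Sum>i\<in>UNIV. u i)\<^sup>2 = s"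
      unfolding k s eq by (simp add: solution_inverse_entries)
    then show ?thesis using eq by blast
  qed
qed

lemma solution_nonzero:
  assumes sol: "(u, \<tau>) \<in> reduced_solutions k s" and k: "\<And>i. k i \<noteq> 0" and s: "s \<noteq> 0"
  shows "u i \<noteq> 0" "1 - \<tau> * (\<Sum>i\<in>UNIV. u i) \<noteq> 0"
proof -
  have "u i - \<tau> * (u i)\<^sup>2 = k i" "(\<Sum>i\<in>UNIV. u i) * (1 - \<tau> * (\<Sum>i\<in>UNIV. u i)) = s"
    using sol by (auto simp: reduced_solutions_def power2_eq_square algebra_simps)
  then show "u i \<noteq> 0" "1 - \<tau> * (\<Sum>i\<in>UNIV. u i) \<noteq> 0" using k[of i] s by auto
qed

lemma critical_points_eq_solutions:
  fixes S :: "complex^'n^'n"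
  defines "k \<equiv> \<lambda>i. matrix_inv S $ i $ i" and "s \<equiv> entry_sum (matrix_inv S)"
  assumes k: "\<And>i. k i \<noteq> 0" and s: "s \<noteq> 0" "s \<noteq> (\<Sum>i\<in>UNIV. k i)"
    "\<And>a. s \<noteq> 2 * k a - (\<Sum>i\<in>UNIV. k i)"
  shows "critical_points complex_star_space S = solution_matrix ` reduced_solutions k s"
proof (intro equalityI subsetI)
  fix X assume "X \<in> critical_points complex_star_space S"
  then have X: "X \<in> complex_star_space" "invertible X"
    "\<And>i. k i = matrix_inv X $ i $ i" "s = entry_sum (matrix_inv X)"
    by (auto simp: critical_points_star_iff k_def s_def)
  from X(1) obtain d t where dt: "X = star_matrix d t" by (rule star_matrix_cases)
  from star_matrix_inverse_cases[OF X(2-4)[unfolded dt]] s(3)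
  obtain u \<tau> where u: "X = solution_matrix (u, \<tau>)" "\<forall>i. u i - \<tau> * (u i)\<^sup>2 = k i"
    "(\<Sum>i\<in>UNIV. u i) - \<tau> * (\<Sum>i\<in>UNIV. u i)\<^sup>2 = s" unfolding dt by blast
  then have "\<tau> \<noteq> 0" using s(2) by auto
  then show "X \<in> solution_matrix ` reduced_solutions k s"
    using u unfolding reduced_solutions_def by blast
next
  fix X assume "X \<in> solution_matrix ` reduced_solutions k s"
  then obtain u \<tau> where u: "(u, \<tau>) \<in> reduced_solutions k s" "X = solution_matrix (u, \<tau>)" by auto
  note nz = solution_nonzero[OF u(1) k s(1)]
  note inverse = solution_matrix_inverse[of u \<tau>, OF nz]
  show "X \<in> critical_points complex_star_space S"
    unfolding critical_points_star_iff u(2) inverse(1)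
    using inverse(2) u(1) by (simp add: solution_inverse_entries reduced_solutions_def k_def s_def)
       (simp add: solution_matrix_def star_matrix_mem)
qed

lemma solution_matrix_inj:
  fixes k :: "'n::finite \<Rightarrow> complex"
  assumes n: "CARD('n) \<ge> 2" and k: "\<And>i. k i \<noteq> 0" and s: "s \<noteq> 0"
  shows "inj_on solution_matrix (reduced_solutions k s)"
proof (rule inj_onI, clarify)
  fix u \<tau> u' \<tau>'
  assume sol: "(u, \<tau>) \<in> reduced_solutions k s" "(u', \<tau>') \<in> reduced_solutions k s"
    and "solution_matrix (u, \<tau>) = solution_matrix (u', \<tau>')"
  then have "(\<lambda>i. 1 / u i) = (\<lambda>i. 1 / u' i)"
    and t: "\<tau> / (1 - \<tau> * (\<Sum>i\<in>UNIV. u i)) = \<tau>' / (1 - \<tau>' * (\<Sum>i\<in>UNIV. u' i))"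
    by (auto simp: solution_matrix_def star_matrix_eq_iff[OF n])
  then have u: "u = u'" by (auto simp: fun_eq_iff)
  have "\<tau> = \<tau>'"
    using t solution_nonzero(2)[OF sol(1) k s] solution_nonzero(2)[OF sol(2) k s] unfolding u
    by (simp add: frac_eq_eq algebra_simps)
  then show "u = u' \<and> \<tau> = \<tau>'" using u by simp
qed

text \<open>Let \<open>diag e + t J\<close> be in the kernel of the Hessian, and put \<open>w = 1 - 2 \<tau> p\<close>, \<open>V i = 1 - 2 \<tau> u\<^sub>i\<close>.  The kernel
equations give \<open>V i * e i = - t w\<close> and \<open>\<Sum> u\<^sub>i\<^sup>2 e i = - t p\<^sup>2\<close>, so that \<open>t (p\<^sup>2 - w \<Sum> u\<^sub>i\<^sup>2 / V i) = 0\<close>.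
The factor next to \<open>t\<close> is nonzero, because \<open>s - w \<Sum> k\<^sub>i / V i\<close> is \<open>\<tau>\<close> times it.\<close>

lemma solution_nondegenerate:
  fixes k :: "'n::finite \<Rightarrow> complex"
  assumes sol: "(u, \<tau>) \<in> reduced_solutions k s" and k: "\<And>i. k i \<noteq> 0" and s: "s \<noteq> 0"
    and v: "\<And>i. 1 - 2 * \<tau> * u i \<noteq> 0"
    and simple: "s \<noteq> (1 - 2 * \<tau> * (\<Sum>i\<in>UNIV. u i)) * (\<Sum>i\<in>UNIV. k i / (1 - 2 * \<tau> * u i))"
    and kernel: "\<And>l. (\<Sum>m\<in>UNIV. trace (solution_inverse (u, \<tau>) ** star_basis m **
      solution_inverse (u, \<tau>) ** star_basis l) * c m) = 0"
  shows "c m = 0"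
proof -
  define p where "p = (\<Sum>i\<in>UNIV. u i)"
  define q where "q = 1 - \<tau> * p"
  define w where "w = 1 - 2 * \<tau> * p"
  define V where "V = (\<lambda>i. 1 - 2 * \<tau> * u i)"
  define t where "t = c None"
  define e where "e = (\<lambda>i. c (Some i))"
  define \<sigma> where "\<sigma> = (\<Sum>i\<in>UNIV. (u i)\<^sup>2 * e i)"
  let ?Q = "solution_inverse (u, \<tau>)"
  have u0: "u i \<noteq> 0" and q0: "q \<noteq> 0" for i
    using solution_nonzero[OF sol k s] by (auto simp: q_def p_def)
  have V0: "V i \<noteq> 0" for i using v by (simp add: V_def)
  have ki: "k i = u i - \<tau> * (u i)\<^sup>2" and s_p: "s = p - \<tau> * p\<^sup>2" for i
    using sol by (auto simp: reduced_solutions_def p_def)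
  have sym: "?Q $ i $ j = ?Q $ j $ i" for i j by (auto simp: solution_inverse_def)
  have diag: "V i * e i = - (\<tau>\<^sup>2 * \<sigma> + t * q\<^sup>2)" for i
  proof -
    have "0 = (\<Sum>m\<in>UNIV. trace (?Q ** star_basis m ** ?Q ** star_basis (Some i)) * c m)"
      by (rule kernel[symmetric])
    also have "\<dots> = (u i * q) * (u i * q) * t + (\<Sum>j\<in>UNIV. ?Q $ i $ j * ?Q $ j $ i * e j)"
      by (simp add: trace_mult_star_basis sum_UNIV_option star_basis_sandwich
          solution_inverse_entries t_def e_def q_def p_def)
    also have "(\<Sum>j\<in>UNIV. ?Q $ i $ j * ?Q $ j $ i * e j) =
        (\<Sum>j\<in>UNIV. (if i = j then (u i)\<^sup>2 * V i * e i else 0) + \<tau>\<^sup>2 * (u i)\<^sup>2 * ((u j)\<^sup>2 * e j))"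
      by (intro sum.cong) (auto simp: solution_inverse_def V_def power2_eq_square algebra_simps)
    also have "\<dots> = (u i)\<^sup>2 * V i * e i + \<tau>\<^sup>2 * (u i)\<^sup>2 * \<sigma>"
      by (simp add: sum.distrib \<sigma>_def sum_distrib_left[symmetric])
    finally have "(u i)\<^sup>2 * (V i * e i + (\<tau>\<^sup>2 * \<sigma> + t * q\<^sup>2)) = 0"
      by (simp add: power2_eq_square algebra_simps)
    then show ?thesis using u0[of i] by (simp add: add_eq_0_iff)
  qed
  have "\<sigma> = - t * p\<^sup>2"
  proof -
    have tot: "entry_sum (?Q ** star_basis m ** ?Q) =
        (case m of None \<Rightarrow> (p * q) * (p * q) | Some a \<Rightarrow> (u a * q) * (u a * q))" for m
    proof (cases m)
      case None
      have "entry_sum (?Q ** star_basis m ** ?Q) = (\<Sum>i\<in>UNIV. \<Sum>j\<in>UNIV. (u i * q) * (u j * q))"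
        by (simp add: entry_sum_def None star_basis_sandwich solution_inverse_entries q_def p_def)
      also have "\<dots> = (\<Sum>i\<in>UNIV. u i * q) * (\<Sum>j\<in>UNIV. u j * q)" by (rule sum_product[symmetric])
      finally show ?thesis using None by (simp add: p_def sum_distrib_right)
    next
      case (Some a)
      have "entry_sum (?Q ** star_basis m ** ?Q) = (\<Sum>i\<in>UNIV. \<Sum>j\<in>UNIV. ?Q $ i $ a * ?Q $ a $ j)"
        by (simp add: entry_sum_def Some star_basis_sandwich)
      also have "\<dots> = (\<Sum>i\<in>UNIV. ?Q $ i $ a) * (\<Sum>j\<in>UNIV. ?Q $ a $ j)" by (rule sum_product[symmetric])
      finally show ?thesis using Some by (simp add: solution_inverse_entries q_def p_def)
    qed
    have "0 = (\<Sum>m\<in>UNIV. trace (?Q ** star_basis m ** ?Q ** star_basis None) * c m)"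
      by (rule kernel[symmetric])
    also have "\<dots> = (p * q) * (p * q) * t + (\<Sum>j\<in>UNIV. (u j * q) * (u j * q) * e j)"
      by (simp add: trace_mult_star_basis sum_UNIV_option tot t_def e_def)
    also have "(\<Sum>j\<in>UNIV. (u j * q) * (u j * q) * e j) = q\<^sup>2 * \<sigma>"
      by (simp add: \<sigma>_def sum_distrib_left power2_eq_square mult_ac)
    finally have "q\<^sup>2 * (\<sigma> + t * p\<^sup>2) = 0" by (simp add: power2_eq_square algebra_simps)
    then show ?thesis using q0 by (simp add: add_eq_0_iff2)
  qed
  note \<sigma> = this
  have "\<tau>\<^sup>2 * \<sigma> + t * q\<^sup>2 = t * w"
    unfolding \<sigma> q_def w_def by (simp add: power2_eq_square algebra_simps)
  then have e: "e i = - t * w / V i" for i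
    using diag[of i] V0[of i] by (simp add: field_simps)
  have "t * (p\<^sup>2 - w * (\<Sum>i\<in>UNIV. (u i)\<^sup>2 / V i)) = 0"
  proof -
    have "\<sigma> = - t * w * (\<Sum>i\<in>UNIV. (u i)\<^sup>2 / V i)"
      unfolding \<sigma>_def e sum_distrib_left by (intro sum.cong) auto
    then show ?thesis unfolding \<sigma> by (simp add: algebra_simps)
  qed
  moreover have "p\<^sup>2 - w * (\<Sum>i\<in>UNIV. (u i)\<^sup>2 / V i) \<noteq> 0"
  proof
    assume zero: "p\<^sup>2 - w * (\<Sum>i\<in>UNIV. (u i)\<^sup>2 / V i) = 0"
    have "k i / V i = u i + \<tau> * ((u i)\<^sup>2 / V i)" for i
      using V0[of i] by (simp add: ki V_def field_simps power2_eq_square)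
    then have "(\<Sum>i\<in>UNIV. k i / V i) = p + \<tau> * (\<Sum>i\<in>UNIV. (u i)\<^sup>2 / V i)"
      by (simp add: sum.distrib p_def sum_distrib_left)
    then have "w * (\<Sum>i\<in>UNIV. k i / V i) = w * p + \<tau> * (w * (\<Sum>i\<in>UNIV. (u i)\<^sup>2 / V i))"
      by (simp add: algebra_simps)
    also have "w * (\<Sum>i\<in>UNIV. (u i)\<^sup>2 / V i) = p\<^sup>2" using zero by simp
    also have "w * p + \<tau> * p\<^sup>2 = s" by (simp add: w_def s_p power2_eq_square algebra_simps)
    finally show False using simple by (simp add: w_def V_def p_def)
  qed
  ultimately have "t = 0" by simp
  then show ?thesis using e by (cases m) (auto simp: t_def e_def)
qed

section \<open>Counting critical points\<close>

lemma reduced_solution_sq: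
  fixes u :: "'n::finite \<Rightarrow> complex"
  assumes "(u, \<tau>) \<in> reduced_solutions k s"
  shows "(1 - 2 * \<tau> * u i)\<^sup>2 = 1 - 4 * \<tau> * k i"
    and "phi (\<lambda>i. 1 - 2 * \<tau> * u i) (s * (4 * \<tau>)) = 0"
    and "1 - of_nat CARD('n) + (\<Sum>i\<in>UNIV. 1 - 2 * \<tau> * u i) = 1 - 2 * \<tau> * (\<Sum>i\<in>UNIV. u i)"
proof -
  have k: "k i = u i - \<tau> * (u i)\<^sup>2" and s: "s = (\<Sum>i\<in>UNIV. u i) - \<tau> * (\<Sum>i\<in>UNIV. u i)\<^sup>2" for i
    using assms by (auto simp: reduced_solutions_def)
  show "(1 - 2 * \<tau> * u i)\<^sup>2 = 1 - 4 * \<tau> * k i"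
    by (simp add: k power2_eq_square algebra_simps)
  show w: "1 - of_nat CARD('n) + (\<Sum>i\<in>UNIV. 1 - 2 * \<tau> * u i) = 1 - 2 * \<tau> * (\<Sum>i\<in>UNIV. u i)"
    by (simp add: sum_subtractf sum_distrib_left)
  show "phi (\<lambda>i. 1 - 2 * \<tau> * u i) (s * (4 * \<tau>)) = 0"
    unfolding phi_def w unfolding s by (simp add: power2_eq_square algebra_simps)
qed

lemma reduced_solutionI:
  fixes v :: "'n::finite \<Rightarrow> complex"
  assumes y: "y \<noteq> 0" and v: "\<And>i. (v i)\<^sup>2 = 1 - y * k i" and phi: "phi v (s * y) = 0"
  shows "(\<lambda>i. 2 * (1 - v i) / y, y / 4) \<in> reduced_solutions k s"
proof -
  have quad: "2 * (1 - x) / y - y / 4 * (2 * (1 - x) / y)\<^sup>2 = (1 - x\<^sup>2) / y" for x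
    using y by (simp add: power2_eq_square field_simps)
  have "2 * (1 - v i) / y - y / 4 * (2 * (1 - v i) / y)\<^sup>2 = k i" for i
  proof -
    have "y * k i = 1 - (v i)\<^sup>2" using v[of i] by simp
    then have "k i = (1 - (v i)\<^sup>2) / y" using y by (simp add: field_simps)
    then show ?thesis unfolding quad by simp
  qed
  moreover have "(\<Sum>i\<in>UNIV. 2 * (1 - v i) / y) - y / 4 * (\<Sum>i\<in>UNIV. 2 * (1 - v i) / y)\<^sup>2 = s"
  proof -
    define w where "w = 1 - of_nat CARD('n) + (\<Sum>i\<in>UNIV. v i)"
    have sum: "(\<Sum>i\<in>UNIV. 2 * (1 - v i) / y) = 2 * (1 - w) / y"
      by (simp add: w_def sum_subtractf sum_divide_distrib[symmetric] sum_distrib_left[symmetric])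
    have "s * y = 1 - w\<^sup>2" using phi by (simp add: phi_def w_def algebra_simps)
    then have "s = (1 - w\<^sup>2) / y" using y by (simp add: field_simps)
    then show ?thesis unfolding sum quad by simp
  qed
  ultimately show ?thesis using y by (simp add: reduced_solutions_def)
qed

text \<open>The map \<open>(u, \<tau>) \<mapsto> 4 \<tau>\<close> is a bijection from the solutions of the reduced system to the nonzero roots
of \<open>p\<close>: the sign choice that belongs to a simple root is unique.\<close>

lemma critical_count_star:
  fixes S :: "complex^'n^'n"
  defines "k \<equiv> \<lambda>i. matrix_inv S $ i $ i" and "s \<equiv> entry_sum (matrix_inv S)"
  assumes n: "CARD('n) \<ge> 2"
    and k: "\<And>i. k i \<noteq> 0" and s: "s \<noteq> 0" "s \<noteq> (\<Sum>i\<in>UNIV. k i)"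
      "\<And>a. s \<noteq> 2 * k a - (\<Sum>i\<in>UNIV. k i)"
    and p: "branch_poly k s p" "p \<noteq> 0"
    and nonbranch: "\<And>i. poly p (1 / k i) \<noteq> 0"
    and simple: "\<And>y. y \<noteq> 0 \<Longrightarrow> poly p y = 0 \<Longrightarrow> poly (pderiv p) y \<noteq> 0"
  shows "critical_count complex_star_space S = enat (card {y. y \<noteq> 0 \<and> poly p y = 0})"
proof -
  define R where "R = {y. y \<noteq> 0 \<and> poly p y = 0}"
  let ?V = "reduced_solutions k s"
  let ?C = "critical_points complex_star_space S"
  let ?v = "\<lambda>u \<tau> i. 1 - 2 * \<tau> * u i"
  have crit: "?C = solution_matrix ` ?V"
    unfolding k_def s_def
    by (rule critical_points_eq_solutions) (use k s in \<open>auto simp: k_def s_def\<close>)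
  have root: "poly p (4 * \<tau>) = 0" "\<tau> \<noteq> 0" if "(u, \<tau>) \<in> ?V" for u \<tau>
  proof -
    note sq = reduced_solution_sq[OF that]
    have "poly p (4 * \<tau>) = (\<Prod>B\<in>UNIV. phi (flip B (?v u \<tau>)) (s * (4 * \<tau>)))"
      by (rule p(1)[unfolded branch_poly_def, rule_format]) (rule sq(1))
    also have "\<dots> = 0"
      by (intro prod_zero bexI[of _ "{}"]) (use sq(2) in \<open>auto simp: flip_def\<close>)
    finally show "poly p (4 * \<tau>) = 0" .
    show "\<tau> \<noteq> 0" using that by (simp add: reduced_solutions_def)
  qed
  have v_nz: "?v u \<tau> i \<noteq> 0" if "(u, \<tau>) \<in> ?V" for u \<tau> i
  proof
    assume "?v u \<tau> i = 0"
    then have "1 - 4 * \<tau> * k i = 0" using reduced_solution_sq(1)[OF that, of i] by simp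
    then have "4 * \<tau> = 1 / k i" using k[of i] by (simp add: field_simps)
    then show False using root(1)[OF that] nonbranch[of i] by simp
  qed
  have simple_root:
    "s \<noteq> (1 - 2 * \<tau> * (\<Sum>i\<in>UNIV. u i)) * (\<Sum>i\<in>UNIV. k i / ?v u \<tau> i)"
    "\<And>v'. (\<And>i. (v' i)\<^sup>2 = 1 - 4 * \<tau> * k i) \<Longrightarrow> phi v' (s * (4 * \<tau>)) = 0 \<Longrightarrow> v' = ?v u \<tau>"
    if "(u, \<tau>) \<in> ?V" for u \<tau>
  proof -
    have "poly (pderiv p) (4 * \<tau>) \<noteq> 0" using root[OF that] by (intro simple) auto
    note * = branch_poly_simple_root[of k s p "?v u \<tau>" "4 * \<tau>", OF p(1) reduced_solution_sq(1)[OF that]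
        v_nz[OF that] reduced_solution_sq(2)[OF that] this]
    show "s \<noteq> (1 - 2 * \<tau> * (\<Sum>i\<in>UNIV. u i)) * (\<Sum>i\<in>UNIV. k i / ?v u \<tau> i)"
      using *(1) unfolding reduced_solution_sq(3)[OF that] .
    show "v' = ?v u \<tau>" if "\<And>i. (v' i)\<^sup>2 = 1 - 4 * \<tau> * k i" "phi v' (s * (4 * \<tau>)) = 0" for v'
      using that by (rule *(2))
  qed
  have "bij_betw (\<lambda>(u, \<tau>). 4 * \<tau>) ?V R"
    unfolding bij_betw_def
  proof (intro conjI inj_onI equalityI subsetI)
    fix x x' assume x: "x \<in> ?V" "x' \<in> ?V" "(case x of (u, \<tau>) \<Rightarrow> 4 * \<tau>) = (case x' of (u, \<tau>) \<Rightarrow> 4 * \<tau>)"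
    obtain u \<tau> u' where u: "x = (u, \<tau>)" "x' = (u', \<tau>)" using x(3) by (cases x; cases x') auto
    note V = x(1,2)[unfolded u]
    have "?v u' \<tau> = ?v u \<tau>"
      by (rule simple_root(2)[OF V(1) reduced_solution_sq(1,2)[OF V(2)]])
    then have "u' = u" using root(2)[OF V(1)] by (auto simp: fun_eq_iff)
    then show "x = x'" using u by simp
  next
    fix y assume "y \<in> (\<lambda>(u, \<tau>). 4 * \<tau>) ` ?V"
    then show "y \<in> R" using root by (auto simp: R_def)
  next
    fix y assume "y \<in> R"
    then have y: "y \<noteq> 0" "poly p y = 0" by (auto simp: R_def)
    define r where "r = (\<lambda>i. csqrt (1 - y * k i))"
    have r: "(r i)\<^sup>2 = 1 - y * k i" for i by (simp add: r_def)
    have "(\<Prod>B\<in>UNIV. phi (flip B r) (s * y)) = 0"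
      using p(1)[unfolded branch_poly_def, rule_format, of r y] r y(2) by simp
    then obtain B where B: "phi (flip B r) (s * y) = 0" by auto
    have "(flip B r i)\<^sup>2 = 1 - y * k i" for i using r[of i] by (simp add: flip_def)
    from reduced_solutionI[OF y(1) this B] show "y \<in> (\<lambda>(u, \<tau>). 4 * \<tau>) ` ?V"
      by (rule rev_image_eqI) simp
  qed
  then have fin_V: "finite ?V" and card_V: "card ?V = card R"
    using poly_roots_finite[OF p(2)] by (auto simp: bij_betw_finite bij_betw_same_card R_def)
  have "multiplicity_at complex_star_space S P = 1" if P: "P \<in> ?C" for P
  proof -
    obtain u \<tau> where sol: "(u, \<tau>) \<in> ?V" and Pu: "P = solution_matrix (u, \<tau>)"
      using P unfolding crit by auto
    have inv_P: "matrix_inv P = solution_inverse (u, \<tau>)"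
      unfolding Pu by (intro solution_matrix_inverse solution_nonzero[OF sol k s(1)])
    note nondeg = solution_nondegenerate[OF sol k s(1) v_nz[OF sol] simple_root(1)[OF sol]]
    show ?thesis
    proof (rule nondegenerate_multiplicity_1[OF P star_basis_inj[OF n] star_basis_mem])
      fix X :: "complex^'n^'n" assume "X \<in> complex_star_space"
      then obtain d t where X: "X = star_matrix d t" by (rule star_matrix_cases)
      obtain d' t' where P': "P = star_matrix d' t'" by (simp add: Pu solution_matrix_def)
      have "X $ i $ j - P $ i $ j =
          (\<Sum>m\<in>UNIV. (case m of None \<Rightarrow> t - t' | Some a \<Rightarrow> d a - d' a) * star_basis m $ i $ j)" for i j
        using star_basis_span[of d t d' t' i j] unfolding X P' by simp
      then show "\<exists>c. \<forall>i j. X $ i $ j - P $ i $ j = (\<Sum>m\<in>UNIV. c m * star_basis m $ i $ j)" by blast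
    next
      fix c m
      assume "\<And>l. (\<Sum>m\<in>UNIV. trace (matrix_inv P ** star_basis m ** matrix_inv P ** star_basis l) * c m) = 0"
      then show "c m = 0" unfolding inv_P by (rule nondeg)
    qed
  qed
  then have "critical_count complex_star_space S = (\<Sum>P\<in>?C. 1)"
    using fin_V by (simp add: critical_count_def crit)
  also have "\<dots> = enat (card ?C)" by (simp add: one_enat_def of_nat_eq_enat)
  also have "card ?C = card R"
    unfolding crit card_V[symmetric] by (rule card_image) (rule solution_matrix_inj[OF n k s(1)])
  finally show ?thesis by (simp add: R_def)
qed

section \<open>Genericity\<close>

text \<open>Entries of \<open>S\<inverse>\<close> are not polynomials in \<open>S\<close>, but become so after multiplication with the determinant;
for nonvanishing conditions on invertible matrices this makes no difference.\<close>

definition rational_funs :: "(complex^'n^'n \<Rightarrow> complex) set" where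
  "rational_funs = {f. \<exists>m. \<exists>g\<in>poly_fun. \<forall>S. invertible S \<longrightarrow> g S = det S ^ m * f S}"

lemma det_poly_fun: "det \<in> poly_fun"
  by (rule poly_fun.det[of "\<lambda>S. S", OF poly_fun.entry])

lemma rational_funsI:
  assumes "g \<in> poly_fun" "\<And>S. invertible S \<Longrightarrow> g S = det S ^ m * f S"
  shows "f \<in> rational_funs"
  unfolding rational_funs_def mem_Collect_eq
  using assms by (intro exI[of _ m] bexI[of _ g] allI impI)

interpretation rational_funs: function_algebra "rational_funs :: (complex^'n^'n \<Rightarrow> complex) set"
proof
  show "(\<lambda>x. c) \<in> rational_funs" for c
    unfolding rational_funs_def by (auto intro!: exI[of _ 0] bexI[OF _ poly_fun.const[of c]])
next
  fix f g :: "complex^'n^'n \<Rightarrow> complex"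
  assume "f \<in> rational_funs" "g \<in> rational_funs"
  then obtain m F l G where F: "F \<in> poly_fun" "\<And>S. invertible S \<Longrightarrow> F S = det S ^ m * f S"
    and G: "G \<in> poly_fun" "\<And>S. invertible S \<Longrightarrow> G S = det S ^ l * g S"
    unfolding rational_funs_def by blast
  have "(\<lambda>S. det S ^ l * F S + det S ^ m * G S) \<in> poly_fun"
    by (intro poly_fun.add poly_fun.mult poly_fun.power F G det_poly_fun)
  moreover have "det S ^ l * F S + det S ^ m * G S = det S ^ (m + l) * (f S + g S)" if "invertible S" for S
    by (simp add: F(2)[OF that] G(2)[OF that] power_add algebra_simps)
  ultimately show "(\<lambda>x. f x + g x) \<in> rational_funs" by (rule rational_funsI)
  have "(\<lambda>S. F S * G S) \<in> poly_fun" by (intro poly_fun.mult F G)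
  moreover have "F S * G S = det S ^ (m + l) * (f S * g S)" if "invertible S" for S
    by (simp add: F(2)[OF that] G(2)[OF that] power_add)
  ultimately show "(\<lambda>x. f x * g x) \<in> rational_funs" by (rule rational_funsI)
qed

lemma matrix_inv_rational: "(\<lambda>S :: complex^'n^'n. matrix_inv S $ i $ j) \<in> rational_funs"
proof -
  have "(\<lambda>S :: complex^'n^'n. (\<chi> r c. if c = i then (if r = j then 1 else 0) else S $ r $ c) $ r $ c) \<in> poly_fun"
    for r c :: 'n
    by (cases "c = i"; cases "r = j") (simp_all add: poly_fun.entry poly_fun.const)
  then have "(\<lambda>S :: complex^'n^'n. det (\<chi> r c. if c = i then (if r = j then 1 else 0) else S $ r $ c)) \<in> poly_fun"
    by (rule poly_fun.det)
  moreover have "det (\<chi> r c. if c = i then (if r = j then 1 else 0) else S $ r $ c) =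
      det S ^ 1 * matrix_inv S $ i $ j" if "invertible S" for S :: "complex^'n^'n"
    using that by (simp add: invertible_det_nz matrix_inv_entry)
  ultimately show ?thesis by (rule rational_funsI)
qed

text \<open>Clearing the denominator of \<open>f\<close> gives the required polynomial; an additional factor \<open>det S\<close> makes
invertibility part of the condition.\<close>

lemma generic_symmetricI:
  assumes f: "f \<in> rational_funs"
    and S0: "transpose S0 = S0" "invertible S0" "f S0 \<noteq> 0"
    and P: "\<And>S. transpose S = S \<Longrightarrow> invertible S \<Longrightarrow> f S \<noteq> 0 \<Longrightarrow> P S"
  shows "generic_symmetric P"
proof -
  obtain m g where g: "g \<in> poly_fun" "\<And>S. invertible S \<Longrightarrow> g S = det S ^ m * f S"
    using f unfolding rational_funs_def by blast
  have "(\<lambda>S. det S * g S) \<in> poly_fun" by (intro poly_fun.mult det_poly_fun g)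
  moreover have "det S0 * g S0 \<noteq> 0" using S0 by (simp add: g invertible_det_nz)
  moreover have "P S" if "transpose S = S" "det S * g S \<noteq> 0" for S
  proof -
    have "invertible S" using that by (simp add: invertible_det_nz)
    then show ?thesis using that g(2) P by simp
  qed
  ultimately show ?thesis
    unfolding generic_symmetric_def using S0(1)
    by (intro bexI[of _ "\<lambda>S. det S * g S"] conjI exI[of _ S0] allI impI) auto
qed

text \<open>The Sylvester matrix is taken for the fixed degrees \<open>D\<close> and \<open>D - 1\<close>, so that its determinant is
polynomial in the coefficients even where the degree of \<open>M\<close> drops.\<close>

lemma simple_roots_of_resultant:
  fixes M :: "complex poly"
  assumes D: "degree M \<le> D" "coeff M D \<noteq> 0" "coeff M 0 \<noteq> 0"
    and res: "resultant_sub D (D - 1) M (pderiv M) \<noteq> 0"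
  shows "card {y. poly M y = 0} = D" "poly M y = 0 \<Longrightarrow> poly (pderiv M) y \<noteq> 0"
proof -
  have deg: "degree M = D" using D by (simp add: le_antisym le_degree)
  have M0: "M \<noteq> 0" using D by auto
  have "resultant M (pderiv M) \<noteq> 0"
    using res by (simp add: resultant_sub deg degree_pderiv)
  then have simple: "\<not> (poly M y = 0 \<and> poly (pderiv M) y = 0)" for y
    using resultant_zero_iff_common_root[OF M0] by blast
  then show "poly M y = 0 \<Longrightarrow> poly (pderiv M) y \<noteq> 0" by blast
  have "rsquarefree M" using simple by (simp add: rsquarefree_roots)
  from complex_poly_decompose_rsquarefree[OF this]
  have "degree M = degree (\<Prod>z | poly M z = 0. [:- z, 1:])"
    using M0 by (metis degree_smult_eq leading_coeff_0_iff)
  also have "\<dots> = (\<Sum>z | poly M z = 0. degree [:- z, 1:])"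
    by (rule degree_prod_eq_sum_degree) auto
  finally show "card {y. poly M y = 0} = D" using deg by simp
qed

text \<open>A polynomial of degree at most \<open>D\<close> with \<open>D\<close> distinct nonzero roots has no room for a double root or
for the root \<open>0\<close>.\<close>

lemma resultant_of_many_roots:
  fixes M :: "complex poly"
  assumes D: "degree M \<le> D" "M \<noteq> 0" "D > 0"
    and Y: "card Y = D" "\<And>y. y \<in> Y \<Longrightarrow> y \<noteq> 0 \<and> poly M y = 0"
  shows "coeff M D \<noteq> 0" "coeff M 0 \<noteq> 0" "resultant_sub D (D - 1) M (pderiv M) \<noteq> 0"
    and "{y. poly M y = 0} = Y"
proof -
  have fin: "finite {y. poly M y = 0}" using D(2) by (rule poly_roots_finite)
  have sub: "Y \<subseteq> {y. poly M y = 0}" using Y(2) by blast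
  have le: "card {y. poly M y = 0} \<le> degree M" using D(2) by (rule card_poly_roots_bound)
  have deg: "degree M = D" using card_mono[OF fin sub] le D(1) Y(1) by simp
  then show "coeff M D \<noteq> 0" using D(2) by auto
  show roots: "{y. poly M y = 0} = Y"
    using card_subset_eq[OF fin sub] card_mono[OF fin sub] le deg Y(1) by simp
  then have "poly M 0 \<noteq> 0" using Y(2)[of 0] by auto
  then show "coeff M 0 \<noteq> 0" by (simp add: poly_0_coeff_0)
  have "\<not> (poly M a = 0 \<and> poly (pderiv M) a = 0)" for a
  proof
    assume a: "poly M a = 0 \<and> poly (pderiv M) a = 0"
    then obtain q where q: "M = [:- a, 1:] * q" by (auto simp: poly_eq_0_iff_dvd elim: dvdE)
    have q0: "q \<noteq> 0" using q D(2) by auto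
    have "poly (pderiv M) a = poly [:- a, 1:] a * poly (pderiv q) a + poly q a * poly (pderiv [:- a, 1:]) a"
      unfolding q pderiv_mult poly_add poly_mult ..
    then have qa: "poly q a = 0" using a by (simp add: pderiv_pCons)
    have "Y \<subseteq> {y. poly q y = 0}"
    proof
      fix y assume "y \<in> Y"
      then have "poly M y = 0" using Y(2) by blast
      then have "y = a \<or> poly q y = 0" unfolding q poly_mult by simp
      then show "y \<in> {y. poly q y = 0}" using qa by auto
    qed
    then have "D \<le> card {y. poly q y = 0}"
      using card_mono[OF poly_roots_finite[OF q0]] Y(1) by blast
    also have "\<dots> \<le> degree q" by (rule card_poly_roots_bound[OF q0])
    finally have "D \<le> degree q" .
    moreover have "degree M = 1 + degree q"
      unfolding q by (subst degree_mult_eq) (use q0 in auto)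
    ultimately show False using deg by simp
  qed
  then have "resultant M (pderiv M) \<noteq> 0"
    using resultant_zero_iff_common_root[OF D(2)] by blast
  then show "resultant_sub D (D - 1) M (pderiv M) \<noteq> 0"
    by (simp add: resultant_sub deg degree_pderiv)
qed

lemma branch_poly_cofactor:
  assumes "branch_poly (k :: 'n::finite \<Rightarrow> complex) s p"
  defines "M \<equiv> poly_shift (CARD('n) + 1) p"
  shows "p = monom 1 (CARD('n) + 1) * M" "degree M \<le> 2 ^ CARD('n) - CARD('n) - 1"
proof -
  obtain q where q: "p = monom 1 (CARD('n) + 1) * q"
    using branch_poly_order_ge[OF assms(1)] by (elim dvdE)
  have "M = q" by (rule poly_eqI) (simp add: M_def q coeff_poly_shift coeff_monom_mult)
  then show p: "p = monom 1 (CARD('n) + 1) * M" using q by simp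
  show "degree M \<le> 2 ^ CARD('n) - CARD('n) - 1"
  proof (cases "M = 0")
    case False
    then have "degree p = CARD('n) + 1 + degree M"
      unfolding p by (subst degree_mult_eq) (auto simp: degree_monom_eq monom_eq_0_iff)
    then show ?thesis using branch_poly_degree_le[OF assms(1)] by simp
  qed simp
qed

text \<open>This expresses \<open>p (1 / x) \<noteq> 0\<close> by a polynomial in \<open>x\<close> and the coefficients of \<open>p\<close>.\<close>

lemma poly_inverse_times_power:
  fixes p :: "'a::field poly"
  assumes "degree p \<le> m" "x \<noteq> 0"
  shows "(\<Sum>j\<le>m. coeff p j * x ^ (m - j)) = x ^ m * poly p (1 / x)"
proof -
  have "poly p (1 / x) = (\<Sum>j\<le>m. coeff p j * (1 / x) ^ j)"
    unfolding poly_altdef using assms(1)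
    by (intro sum.mono_neutral_left) (auto simp: coeff_eq_0)
  then have "x ^ m * poly p (1 / x) = (\<Sum>j\<le>m. x ^ m * (coeff p j * (1 / x) ^ j))"
    by (simp add: sum_distrib_left)
  also have "\<dots> = (\<Sum>j\<le>m. coeff p j * x ^ (m - j))"
    using assms(2) by (intro sum.cong) (auto simp: power_diff power_divide)
  finally show ?thesis by simp
qed

text \<open>Take the inverse of the matrix with diagonal \<open>k\<close> and all other entries equal to
\<open>c = (s - \<Sum> k\<^sub>i) / (n (n - 1))\<close>, which is invertible once \<open>c\<close> exceeds all \<open>k\<^sub>i\<close>: if \<open>\<sigma>\<close> is the sum of the
entries of a kernel vector, then \<open>\<sigma> = \<sigma> \<Sum> c / (c - k\<^sub>i)\<close>, and the sum is greater than \<open>1\<close>.\<close>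

lemma symmetric_matrix_with_parameters:
  fixes k :: "'n::finite \<Rightarrow> real" and s :: real
  assumes n: "CARD('n) \<ge> 2" and k: "\<And>i. k i > 0"
    and s: "s > (\<Sum>i\<in>UNIV. k i) + (real CARD('n))\<^sup>2 * (\<Sum>i\<in>UNIV. k i)"
  obtains S :: "complex^'n^'n" where "transpose S = S" "invertible S"
    "\<And>i. matrix_inv S $ i $ i = of_real (k i)" "entry_sum (matrix_inv S) = of_real s"
proof -
  define N where "N = real CARD('n)"
  define K where "K = (\<Sum>i\<in>UNIV. k i)"
  define c where "c = (s - K) / (N * (N - 1))"
  have N: "N \<ge> 2" using n by (simp add: N_def)
  have K0: "K > 0" unfolding K_def by (rule sum_pos) (use k in auto)
  have kK: "k i \<le> K" for i unfolding K_def by (rule member_le_sum) (use k in \<open>auto intro: less_imp_le\<close>)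
  have "K < c"
  proof -
    have "K * (N * (N - 1)) \<le> N\<^sup>2 * K" using N K0 by (simp add: power2_eq_square algebra_simps)
    also have "\<dots> < s - K" using s by (simp add: N_def K_def)
    finally show ?thesis using N by (simp add: c_def pos_less_divide_eq)
  qed
  then have c: "k i < c" for i using kK[of i] by linarith
  define A :: "complex^'n^'n" where "A = star_matrix (\<lambda>i. of_real (k i - c)) (of_real c)"
  have A_sym: "transpose A = A" by (auto simp: A_def star_matrix_def transpose_def vec_eq_iff)
  have A_diag: "A $ i $ i = of_real (k i)" for i by (simp add: A_def star_matrix_def)
  have A_sum: "entry_sum A = of_real s"
  proof -
    have "(\<Sum>j\<in>UNIV. A $ i $ j) = of_real (k i - c + N * c)" for i
      by (simp add: A_def star_matrix_def sum.distrib N_def)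
    then have "entry_sum A = of_real (\<Sum>i\<in>UNIV. k i - c + N * c)" by (simp add: entry_sum_def)
    also have "(\<Sum>i\<in>UNIV. k i - c + N * c) = K + N * (N - 1) * c"
      by (simp add: sum.distrib sum_subtractf K_def N_def algebra_simps)
    also have "\<dots> = s" using N by (simp add: c_def)
    finally show ?thesis .
  qed
  have "x = 0" if x: "A *v x = 0" for x
  proof -
    define \<sigma> where "\<sigma> = (\<Sum>j\<in>UNIV. x $ j)"
    define r where "r = (\<Sum>i\<in>UNIV. c / (c - k i))"
    have row: "x $ i = of_real (c / (c - k i)) * \<sigma>" for i
    proof -
      have "(A *v x) $ i = (\<Sum>j\<in>UNIV. (if i = j then of_real (k i - c) * x $ i else 0) + of_real c * x $ j)"
        unfolding matrix_vector_mult_def by (auto simp: A_def star_matrix_def algebra_simps intro!: sum.cong)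
      then have "of_real (k i - c) * x $ i + of_real c * \<sigma> = 0"
        using x by (simp add: sum.distrib \<sigma>_def sum_distrib_left)
      then have "of_real (c - k i) * x $ i = of_real c * \<sigma>" by (simp add: algebra_simps)
      moreover have "complex_of_real (c - k i) \<noteq> 0" using c[of i] by (simp only: of_real_eq_0_iff)
      ultimately show ?thesis by (simp add: field_simps)
    qed
    have "\<sigma> = of_real r * \<sigma>"
    proof -
      have "\<sigma> = (\<Sum>i\<in>UNIV. of_real (c / (c - k i)) * \<sigma>)" unfolding row[symmetric] by (simp add: \<sigma>_def)
      then show ?thesis by (simp only: r_def of_real_sum sum_distrib_right)
    qed
    moreover have "r > 1"
    proof -
      have "1 \<le> c / (c - k i)" for i using c[of i] k[of i] by (simp add: field_simps)
      then have "(\<Sum>i\<in>(UNIV :: 'n set). 1) \<le> r" unfolding r_def by (intro sum_mono) auto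
      then show ?thesis using n by simp
    qed
    ultimately have "\<sigma> = 0" by (metis mult_cancel_right1 of_real_eq_1_iff less_irrefl)
    then show ?thesis using row by (simp add: vec_eq_iff)
  qed
  then have A_inv: "invertible A"
    using matrix_left_invertible_ker invertible_left_inverse by blast
  define S where "S = matrix_inv A"
  have AS: "A ** S = mat 1" "S ** A = mat 1" using matrix_inv_inverse[OF A_inv] by (auto simp: S_def)
  have S: "matrix_inv S = A" "invertible S" by (rule matrix_inv_eqI[OF AS(2,1)])+
  have "transpose S = S"
  proof -
    have "A ** transpose S = mat 1" "transpose S ** A = mat 1"
      using AS A_sym by (metis matrix_transpose_mul transpose_mat)+
    then have "matrix_inv A = transpose S" by (rule matrix_inv_eqI(1))
    then show ?thesis unfolding S_def by (rule sym)
  qed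
  then show thesis using S A_diag A_sum by (intro that) auto
qed

theorem theorem4p1:
  assumes "CARD('n::finite) \<ge> 2"
  shows "has_reciprocal_ml_degree (star_BM_model :: (real^'n^'n) set)
           (2 ^ CARD('n) - CARD('n) - 1)"
proof -
  let ?n = "CARD('n)"
  define D where "D = 2 ^ ?n - ?n - (1::nat)"
  have D_pos: "D > 0"
  proof -
    have "m + 2 \<le> 2 ^ m" if "m \<ge> 2" for m :: nat
      using that by (induction m rule: dec_induct) auto
    from this[OF assms] show ?thesis by (simp add: D_def)
  qed
  define k where "k = (\<lambda>i (S :: complex^'n^'n). matrix_inv S $ i $ i)"
  define s where "s = (\<lambda>S :: complex^'n^'n. entry_sum (matrix_inv S))"
  have k_rat: "k i \<in> rational_funs" for i unfolding k_def by (rule matrix_inv_rational)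
  have s_rat: "s \<in> rational_funs"
    unfolding s_def entry_sum_def by (intro rational_funs.sum matrix_inv_rational)
  obtain p where p_rat: "\<And>j. (\<lambda>S. coeff (p S) j) \<in> rational_funs"
    and p: "\<And>S. branch_poly (\<lambda>i. k i S) (s S) (p S)"
    using rational_funs.branch_poly_exists[of k s, OF k_rat s_rat] by blast
  define M where "M = (\<lambda>S. poly_shift (?n + 1) (p S))"
  have M_rat: "(\<lambda>S. coeff (M S) j) \<in> rational_funs" for j
    unfolding M_def coeff_poly_shift by (rule p_rat)
  have M'_rat: "(\<lambda>S. coeff (pderiv (M S)) j) \<in> rational_funs" for j
    unfolding coeff_pderiv by (intro rational_funs.mult rational_funs.const M_rat)
  have pM: "p S = monom 1 (?n + 1) * M S" and deg_M: "degree (M S) \<le> D" for S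
    using branch_poly_cofactor[OF p[of S]] by (auto simp: M_def D_def)
  define K where "K = (\<lambda>S. \<Sum>i\<in>UNIV. k i S)"
  define branch where "branch = (\<lambda>S. \<Prod>i\<in>UNIV. \<Sum>j\<le>2 ^ ?n. coeff (p S) j * k i S ^ (2 ^ ?n - j))"
  \<comment> \<open>The generic condition: \<open>M\<close> has \<open>D\<close> simple nonzero roots, none of them is a branch point \<open>1 / k\<^sub>i\<close>, and
    \<open>k\<close> and \<open>s\<close> satisfy the inequations that exclude critical points with \<open>d\<^sub>a = 0\<close> or \<open>\<tau> = 0\<close>.\<close>
  define f where "f = (\<lambda>S. coeff (M S) D * coeff (M S) 0 * resultant_sub D (D - 1) (M S) (pderiv (M S)) *
    ((\<Prod>i\<in>UNIV. k i S) * s S * (s S - K S) * (\<Prod>a\<in>UNIV. s S - (2 * k a S - K S)) * branch S))"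
  have K_rat: "K \<in> rational_funs" unfolding K_def by (intro rational_funs.sum k_rat)
  have f_rat: "f \<in> rational_funs"
    unfolding f_def branch_def
    by (intro rational_funs.mult rational_funs.prod rational_funs.sum rational_funs.power
        rational_funs.diff rational_funs.const rational_funs.resultant_sub
        k_rat s_rat K_rat M_rat M'_rat p_rat)
  have branch_iff: "branch S \<noteq> 0 \<longleftrightarrow> (\<forall>i. poly (p S) (1 / k i S) \<noteq> 0)" if "\<And>i. k i S \<noteq> 0" for S
    using that by (simp add: branch_def poly_inverse_times_power branch_poly_degree_le[OF p])
  have good: "critical_count complex_star_space S = enat D" if "f S \<noteq> 0" for S
  proof -
    have M: "coeff (M S) D \<noteq> 0" "coeff (M S) 0 \<noteq> 0" "resultant_sub D (D - 1) (M S) (pderiv (M S)) \<noteq> 0"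
      and k0: "k i S \<noteq> 0" and s0: "s S \<noteq> 0" "s S \<noteq> K S" "s S \<noteq> 2 * k i S - K S" and "branch S \<noteq> 0" for i
      using that by (auto simp: f_def)
    then have nonbranch: "poly (p S) (1 / k i S) \<noteq> 0" for i using branch_iff by blast
    note M_roots = simple_roots_of_resultant[OF deg_M M]
    have "poly (M S) 0 \<noteq> 0" using M(2) by (simp add: poly_0_coeff_0)
    then have roots: "{y. y \<noteq> 0 \<and> poly (p S) y = 0} = {y. poly (M S) y = 0}"
      unfolding pM by (auto simp: poly_monom)
    have "poly (pderiv (p S)) y \<noteq> 0" if y: "y \<noteq> 0" "poly (p S) y = 0" for y
    proof -
      have "poly (M S) y = 0" using y roots by blast
      then have "poly (pderiv (p S)) y = y ^ (?n + 1) * poly (pderiv (M S)) y"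
        unfolding pM pderiv_mult by (simp add: poly_monom)
      then show ?thesis using M_roots(2)[OF \<open>poly (M S) y = 0\<close>] y(1) by simp
    qed
    moreover have "p S \<noteq> 0" using pM[of S] M(1) by auto
    ultimately have "critical_count complex_star_space S = enat (card {y. y \<noteq> 0 \<and> poly (p S) y = 0})"
      using assms k0 s0 nonbranch p[of S] unfolding k_def s_def K_def
      by (intro critical_count_star) auto
    then show ?thesis unfolding roots M_roots(1) .
  qed
  have "\<exists>S0. transpose S0 = S0 \<and> invertible S0 \<and> f S0 \<noteq> 0"
  proof -
    obtain kr :: "'n \<Rightarrow> real" and b :: real where kr: "\<And>i. kr i > 0" "b > 0"
      "\<And>s p. s > b \<Longrightarrow> branch_poly (\<lambda>i. complex_of_real (kr i)) (of_real s) p \<Longrightarrow>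
         poly p (-1) \<noteq> 0 \<and>
         (\<exists>Y. Y \<subseteq> {..<0} \<and> finite Y \<and> card Y = 2 ^ ?n - ?n - 1 \<and> (\<forall>y\<in>Y. poly p (of_real y) = 0))"
      by (rule branch_poly_many_roots) blast
    define Kr where "Kr = (\<Sum>i\<in>UNIV. kr i)"
    \<comment> \<open>Large enough for \<open>branch_poly_many_roots\<close> and \<open>symmetric_matrix_with_parameters\<close>, and larger than \<open>Kr\<close>.\<close>
    define sr where "sr = b + Kr + (real ?n)\<^sup>2 * Kr"
    have Kr: "Kr > 0" "kr i \<le> Kr" for i
    proof -
      show "Kr > 0" unfolding Kr_def by (rule sum_pos) (use kr(1) in auto)
      show "kr i \<le> Kr" unfolding Kr_def
        by (rule member_le_sum) (use kr(1) in \<open>auto intro: less_imp_le\<close>)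
    qed
    have sr: "sr > b" "sr > Kr" "sr > Kr + (real ?n)\<^sup>2 * Kr"
      using kr(2) Kr(1) by (auto simp: sr_def intro: add_pos_nonneg)
    obtain S :: "complex^'n^'n" where S: "transpose S = S" "invertible S"
      "\<And>i. matrix_inv S $ i $ i = of_real (kr i)" "entry_sum (matrix_inv S) = of_real sr"
      using symmetric_matrix_with_parameters[OF assms kr(1) sr(3)[unfolded Kr_def]] by blast
    have kS: "k i S = of_real (kr i)" and sS: "s S = of_real sr" and KS: "K S = of_real Kr" for i
      by (simp_all add: k_def s_def K_def Kr_def S)
    obtain Y where Y: "Y \<subseteq> {..<0}" "card Y = D" "\<forall>y\<in>Y. poly (p S) (of_real y) = 0"
      and p1: "poly (p S) (-1) \<noteq> 0"
      using kr(3)[OF sr(1), of "p S"] p[of S] unfolding kS sS D_def by blast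
    have M0: "M S \<noteq> 0" using p1 unfolding pM by auto
    have M_root: "y \<noteq> 0 \<and> poly (M S) y = 0" if "y \<in> complex_of_real ` Y" for y
      using that Y(1,3) unfolding pM by (auto simp: poly_monom)
    have card_Y: "card (complex_of_real ` Y) = D" using Y(2) by (simp add: card_image inj_on_def)
    note M = resultant_of_many_roots[OF deg_M M0 D_pos card_Y M_root]
    have "poly (p S) (1 / k i S) \<noteq> 0" for i
    proof
      assume zero: "poly (p S) (1 / k i S) = 0"
      have "1 / k i S = of_real (1 / kr i)" by (simp add: kS)
      then have "poly (M S) (of_real (1 / kr i)) = 0"
        using zero kr(1)[of i] unfolding pM by (simp add: poly_monom)
      then have "complex_of_real (1 / kr i) \<in> complex_of_real ` Y" using M(4) by blast
      then obtain y where "y \<in> Y" "complex_of_real (1 / kr i) = of_real y" by (elim imageE)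
      then have "1 / kr i < 0" using Y(1) by (simp only: of_real_eq_iff) auto
      moreover have "1 / kr i > 0" using kr(1)[of i] by simp
      ultimately show False by linarith
    qed
    moreover have k0: "k i S \<noteq> 0" for i using kr(1)[of i] by (simp add: kS)
    ultimately have "branch S \<noteq> 0" using branch_iff[of S] by blast
    moreover have "s S - (2 * k a S - K S) \<noteq> 0" for a
    proof -
      have "sr - (2 * kr a - Kr) \<noteq> 0" using sr(2) Kr(2)[of a] by simp
      moreover have "s S - (2 * k a S - K S) = of_real (sr - (2 * kr a - Kr))"
        by (simp add: kS sS KS)
      ultimately show ?thesis by (simp only: of_real_eq_0_iff not_False_eq_True)
    qed
    moreover have "s S - K S \<noteq> 0" "s S \<noteq> 0" using sr(2) Kr(1) by (auto simp: sS KS)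
    ultimately have "f S \<noteq> 0" using M(1-3) k0 by (simp add: f_def)
    then show ?thesis using S(1,2) by blast
  qed
  then obtain S0 where S0: "transpose S0 = S0" "invertible S0" "f S0 \<noteq> 0" by blast
  have "generic_symmetric (\<lambda>S :: complex^'n^'n. invertible S \<and>
      critical_count complex_star_space S = enat D)"
    by (rule generic_symmetricI[OF f_rat S0]) (simp add: good)
  then show ?thesis
    by (simp add: has_reciprocal_ml_degree_def span_star_BM_model D_def)
qed

end
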